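(* Let $a,b,c,\lambda\in\mathbb{C}$ with $c\notin\{0,-1,-2,\ldots\}$ and $\operatorname{Re}\lambda>-1$, let $\varepsilon\in\{1,-1\}$, and let $m\ge0$ be an integer. If $\varepsilon=1$, assume also $\operatorname{Re}(c-a-b)>-1$. Suppose that $(j+\lambda+1-a)(j+\lambda+1-b)\ne0$ for $1\le j\le m$. Define $$\rho_j=\rho_j(\lambda;a,b,c,\varepsilon)=\frac{(j+\lambda)(j+\lambda+1-c)}{\varepsilon(j+\lambda+1-a)(j+\lambda+1-b)}.$$ Then $$\Phi_{m,\varepsilon}(\lambda;a,b,c)=\left(\prod_{\ell=1}^{m}\rho_\ell\right)\Phi_{0,\varepsilon}(\lambda;a,b,c)+\sum_{j=1}^{m}\frac{E_\varepsilon(j+\lambda;a,b,c)}{\varepsilon(j+\lambda+1-a)(j+\lambda+1-b)}\prod_{\ell=j+1}^{m}\rho_\ell .$$ Empty products are $1$, and the sum is empty when $m=0$.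
   Context: $F(a,b;c;z)={}_2F_1(a,b;c;z)$ is the Gauss hypergeometric function, given by $\sum_{n\ge0}\frac{(a)_n(b)_n}{(c)_n n!}z^n$ for $|z|<1$ and by its principal analytic continuation to $\mathbb{C}\setminus[1,\infty)$, where $(u)_0=1$ and $(u)_n=u(u+1)\cdots(u+n-1)$. The moments are $$\Phi_{m,\varepsilon}(\lambda;a,b,c)=\int_0^1x^{m+\lambda}F(a,b;c;\varepsilon x)\,dx .$$ The term $E_\varepsilon(M;a,b,c)$ is defined, for $\varepsilon=1$, by $$E_+(M;a,b,c)=E_+(a,b,c)=\frac{\Gamma(c)\Gamma(c-a-b+1)}{\Gamma(c-a)\Gamma(c-b)}$$ (with $1/\Gamma(z)=0$ at non-positive integers $z$), and, for $\varepsilon=-1$, by $$E_-(M;a,b,c)=(c+a+b-2M-2)F(a,b;c;-1)-2\left.\frac{d}{dz}F(a,b;c;z)\right|_{z=-1}.$$ *)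

theory Defs
  imports "HOL-Analysis.Analysis"
begin

lemma fps_hypergeo_2_1_nth:
  fixes a b c :: complex
  shows "fps_nth (fps_hypergeo [a, b] [c] 1) n =
           pochhammer a n * pochhammer b n / (pochhammer c n * fact n)"
  by simp

(* Uniqueness on the slit plane follows from the identity theorem (the slit plane is connected).
   On the cut [1,\<infinity>) the value is arbitrary; it is never used below, except at the
   single point x = 1 of the integral for \<epsilon> = 1, which is a null set. *)
definition gauss_F :: "complex \<Rightarrow> complex \<Rightarrow> complex \<Rightarrow> complex \<Rightarrow> complex" where
  "gauss_F a b c =
     (SOME f. f holomorphic_on (UNIV - complex_of_real ` {1..}) \<and>
              (\<forall>z. norm z < 1 \<longrightarrow> f z = eval_fps (fps_hypergeo [a, b] [c] 1) z))"

definition Phi :: "nat \<Rightarrow> complex \<Rightarrow> complex \<Rightarrow> complex \<Rightarrow> complex \<Rightarrow> complex \<Rightarrow> complex" where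
  "Phi m \<epsilon> lam a b c =
     (LINT x:{0..1}|lborel.
        complex_of_real x powr (of_nat m + lam) * gauss_F a b c (\<epsilon> * complex_of_real x))"

(* The reciprocal Gamma function is entire and vanishes at the non-positive integers. *)
definition E_plus :: "complex \<Rightarrow> complex \<Rightarrow> complex \<Rightarrow> complex" where
  "E_plus a b c = Gamma c * Gamma (c - a - b + 1) * rGamma (c - a) * rGamma (c - b)"

definition E_minus :: "complex \<Rightarrow> complex \<Rightarrow> complex \<Rightarrow> complex \<Rightarrow> complex" where
  "E_minus M a b c =
     (c + a + b - 2 * M - 2) * gauss_F a b c (-1) - 2 * deriv (gauss_F a b c) (-1)"

definition E_term :: "complex \<Rightarrow> complex \<Rightarrow> complex \<Rightarrow> complex \<Rightarrow> complex \<Rightarrow> complex" where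
  "E_term \<epsilon> M a b c = (if \<epsilon> = 1 then E_plus a b c else E_minus M a b c)"

definition rho :: "nat \<Rightarrow> complex \<Rightarrow> complex \<Rightarrow> complex \<Rightarrow> complex \<Rightarrow> complex \<Rightarrow> complex" where
  "rho j lam a b c \<epsilon> =
     ((of_nat j + lam) * (of_nat j + lam + 1 - c)) /
     (\<epsilon> * (of_nat j + lam + 1 - a) * (of_nat j + lam + 1 - b))"

end

theory Submission
  imports Defs "HOL-Complex_Analysis.Conformal_Mappings"
begin

text \<open>
  Put M = j + \<lambda>, so Re M > 0 for j \<ge> 1, and let I(s) be the integral of x^s F(\<epsilon> x) over (0, 1). The
  formula is the iteration of the first-order recurrence

    \<epsilon> (M + 1 - a) (M + 1 - b) I(M) = M (M + 1 - c) I(M - 1) + E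

  (moment_recurrence_E_term). The recurrence is integration by parts in the hypergeometric equation:
  the expression boundary_form, assembled from F and F' with powers of x, has a derivative that
  the equation reduces to \<epsilon> (M + 1 - a)(M + 1 - b) x^M F - M (M + 1 - c) x^{M-1} F. It vanishes at 0,
  so E is its limit at 1. Three points carry the analysis.

  For \<epsilon> = -1 the point -1 is interior to the slit plane and the limit is the value of the boundary
  form there. This uses the continuation of F, and hence that a continuation exists: without it
  the chosen function gauss_F would be unspecified. For Re b and Re (c - b) large, Euler's integral
  is holomorphic on the slit plane and agrees with the series in the disc, once the Beta integral
  is known for complex parameters. First-order differential operators that lower b and c by one
  then give all remaining parameters (slit_continuable_gauss), and the differential equation
  extends from the disc by the identity theorem (gauss_F_ode).

  For \<epsilon> = 1 the endpoint is the singular point of the equation. Up to a vanishing correction the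
  boundary form tends to the limit of (1 - x) F' + (c - a - b) F, which equals
  (c - a)(c - b)/c F(a, b; c + 1; x). Since Re (c + 1 - a - b) > 0, Gauss's summation theorem
  (gauss_summation) evaluates the limit, and the functional equation of Gamma turns it into E_plus.

  For the same sign the convergence of the integrals needs an argument. Comparing the coefficients
  of F with those of (1 - x)^{-\<sigma>} gives F = O((1 - x)^{-\<sigma>}) with some \<sigma> < 1 because
  Re (c - a - b) > -1, so the moments are dominated by Beta integrals.
\<close>

section \<open>Growth of quotients of Pochhammer symbols\<close>

text \<open>
  The sequence rGamma_series z n, which tends to the reciprocal Gamma function, is (z)_{n+1}
  divided by n! n^z. In a quotient of two symbols by two symbols the factorials cancel, and
  only the power n^{a+b-c-s} and a convergent factor remain. All growth estimates for the Gauss coefficients come from this one identity, with different choices of s.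
\<close>

lemma pochhammer_ratio_asymptotic:
  fixes a b c s :: complex
  assumes "c \<notin> \<int>\<^sub>\<le>\<^sub>0" "s \<notin> \<int>\<^sub>\<le>\<^sub>0"
  defines "q \<equiv> (\<lambda>n. pochhammer a n * pochhammer b n / (pochhammer c n * pochhammer s n))"
  obtains Q where "Q \<longlonglongrightarrow> rGamma a * rGamma b * Gamma c * Gamma s"
    and "\<And>n. n \<ge> 1 \<Longrightarrow> q (Suc n) = Q n * exp ((a + b - c - s) * of_real (ln (of_nat n)))"
proof -
  \<comment> \<open>The limit stays valid if a or b is a non-positive integer, where rGamma vanishes.\<close>
  define Q where "Q = (\<lambda>n. rGamma_series a n * rGamma_series b n * Gamma_series c n * Gamma_series s n)"
  show ?thesis
  proof (rule that[of Q])
    show "Q \<longlonglongrightarrow> rGamma a * rGamma b * Gamma c * Gamma s"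
      unfolding Q_def by (intro tendsto_intros Gamma_series_LIMSEQ rGamma_series_LIMSEQ)
    fix n :: nat assume "n \<ge> 1"
    show "q (Suc n) = Q n * exp ((a + b - c - s) * of_real (ln (of_nat n)))"
    proof -
      define E where "E = (\<lambda>z::complex. exp (z * of_real (ln (of_nat n))))"
      have "exp ((a + b - c - s) * of_real (ln (of_nat n))) = E a * E b / (E c * E s)"
        unfolding E_def by (simp add: ring_distribs exp_add exp_diff)
      moreover have "pa * pb / (pc * ps) =
          pa / (f * E a) * (pb / (f * E b)) * (f * E c / pc) * (f * E s / ps) * (E a * E b / (E c * E s))"
        if "f \<noteq> 0" for f pa pb pc ps :: complex
      proof -
        have "E z \<noteq> 0" for z by (simp add: E_def)
        then show ?thesis using that by simp
      qed
      ultimately show ?thesis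
        by (simp only: q_def Q_def rGamma_series_def Gamma_series_def E_def Suc_eq_plus1 fact_nonzero
              not_False_eq_True)
    qed
  qed
qed

lemma norm_exp_mult_ln:
  assumes "n \<ge> (1::nat)"
  shows "norm (exp (z * of_real (ln (of_nat n)))) = real n powr Re z"
  using assms by (simp add: powr_def mult.commute)

lemma pochhammer_ratio_bound:
  fixes a b c s :: complex
  assumes "c \<notin> \<int>\<^sub>\<le>\<^sub>0" "s \<notin> \<int>\<^sub>\<le>\<^sub>0"
  obtains K where "K > 0" "\<And>n. n \<ge> 1 \<Longrightarrow>
    norm (pochhammer a (Suc n) * pochhammer b (Suc n) / (pochhammer c (Suc n) * pochhammer s (Suc n)))
      \<le> K * real n powr Re (a + b - c - s)"
proof -
  obtain Q where Q: "Q \<longlonglongrightarrow> rGamma a * rGamma b * Gamma c * Gamma s"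
    and eq: "\<And>n. n \<ge> 1 \<Longrightarrow> pochhammer a (Suc n) * pochhammer b (Suc n) / (pochhammer c (Suc n) * pochhammer s (Suc n))
       = Q n * exp ((a + b - c - s) * of_real (ln (of_nat n)))"
    by (rule pochhammer_ratio_asymptotic[OF assms, of a b]) blast
  obtain K where "K > 0" and K: "\<And>n. norm (Q n) \<le> K"
    using convergent_imp_Bseq[OF convergentI[OF Q]] unfolding Bseq_def by blast
  show ?thesis
  proof (rule that[OF \<open>K > 0\<close>])
    fix n :: nat assume n: "n \<ge> 1"
    show "norm (pochhammer a (Suc n) * pochhammer b (Suc n) / (pochhammer c (Suc n) * pochhammer s (Suc n)))
            \<le> K * real n powr Re (a + b - c - s)"
      unfolding eq[OF n] norm_mult norm_exp_mult_ln[OF n] by (intro mult_right_mono K) simp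
  qed
qed

lemma pochhammer_ratio_Bseq:
  fixes a b c s :: complex
  assumes "c \<notin> \<int>\<^sub>\<le>\<^sub>0" "s \<notin> \<int>\<^sub>\<le>\<^sub>0" "Re (a + b) \<le> Re (c + s)"
  shows "Bseq (\<lambda>n. pochhammer a n * pochhammer b n / (pochhammer c n * pochhammer s n))"
proof -
  obtain K where K: "K > 0" "\<And>n. n \<ge> 1 \<Longrightarrow>
    norm (pochhammer a (Suc n) * pochhammer b (Suc n) / (pochhammer c (Suc n) * pochhammer s (Suc n)))
      \<le> K * real n powr Re (a + b - c - s)"
    by (rule pochhammer_ratio_bound[OF assms(1,2), of a b]) blast
  have "real n powr Re (a + b - c - s) \<le> 1" if "n \<ge> 1" for n
    using powr_mono[of "Re (a + b - c - s)" 0 "real n"] that assms(3) by simp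
  then have "norm (pochhammer a (Suc n) * pochhammer b (Suc n) / (pochhammer c (Suc n) * pochhammer s (Suc n)))
      \<le> K * 1" if "n \<ge> 1" for n
    using K that by (meson mult_left_mono order.trans less_imp_le)
  then have "eventually (\<lambda>n. norm (pochhammer a (Suc n) * pochhammer b (Suc n) / (pochhammer c (Suc n) * pochhammer s (Suc n)))
      \<le> K) sequentially"
    by (intro eventually_sequentiallyI[of 1]) simp
  then have "Bseq (\<lambda>n. pochhammer a (Suc n) * pochhammer b (Suc n) / (pochhammer c (Suc n) * pochhammer s (Suc n)))"
    by (rule BfunI)
  then show ?thesis by (subst (asm) Bseq_Suc_iff)
qed

lemma pochhammer_ratio_tendsto_0:
  fixes a b c s :: complex
  assumes "c \<notin> \<int>\<^sub>\<le>\<^sub>0" "s \<notin> \<int>\<^sub>\<le>\<^sub>0" "Re (a + b) < Re (c + s)"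
  shows "(\<lambda>n. pochhammer a n * pochhammer b n / (pochhammer c n * pochhammer s n)) \<longlonglongrightarrow> 0"
proof -
  obtain K where K: "K > 0" "\<And>n. n \<ge> 1 \<Longrightarrow>
    norm (pochhammer a (Suc n) * pochhammer b (Suc n) / (pochhammer c (Suc n) * pochhammer s (Suc n)))
      \<le> K * real n powr Re (a + b - c - s)"
    by (rule pochhammer_ratio_bound[OF assms(1,2), of a b]) blast
  have "(\<lambda>n. real n powr Re (a + b - c - s)) \<longlonglongrightarrow> 0"
    using assms(3) by (intro tendsto_neg_powr filterlim_real_sequentially) simp
  then have lim: "(\<lambda>n. K * real n powr Re (a + b - c - s)) \<longlonglongrightarrow> 0"
    by (rule tendsto_mult_right_zero)
  have "(\<lambda>n. pochhammer a (Suc n) * pochhammer b (Suc n) / (pochhammer c (Suc n) * pochhammer s (Suc n)))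
          \<longlonglongrightarrow> 0"
    by (rule Lim_null_comparison[OF eventually_sequentiallyI[of 1] lim]) (use K in blast)
  then show ?thesis by (rule LIMSEQ_imp_Suc)
qed

section \<open>The Gauss series in the unit disc\<close>

definition hypergeo_coeff :: "complex \<Rightarrow> complex \<Rightarrow> complex \<Rightarrow> nat \<Rightarrow> complex" where
  "hypergeo_coeff a b c n = pochhammer a n * pochhammer b n / (pochhammer c n * fact n)"

lemma pochhammer_nonzero: "c \<notin> \<int>\<^sub>\<le>\<^sub>0 \<Longrightarrow> pochhammer (c::complex) n \<noteq> 0"
  by (auto simp: pochhammer_eq_0_iff)

lemma notin_nonpos_Ints_if_Re_pos: "Re u > 0 \<Longrightarrow> u \<notin> \<int>\<^sub>\<le>\<^sub>0"
  by (auto elim!: nonpos_Ints_cases)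

lemma add_of_nat_notin_nonpos_Ints: "c \<notin> \<int>\<^sub>\<le>\<^sub>0 \<Longrightarrow> c + of_nat n \<notin> (\<int>\<^sub>\<le>\<^sub>0 :: complex set)"
  by (metis add_diff_cancel_right' nonpos_Ints_diff_Nats of_nat_in_Nats)

lemma hypergeo_coeff_0 [simp]: "hypergeo_coeff a b c 0 = 1"
  by (simp add: hypergeo_coeff_def)

lemma hypergeo_coeff_Suc:
  assumes "c \<notin> \<int>\<^sub>\<le>\<^sub>0"
  shows "hypergeo_coeff a b c (Suc n) * (c + of_nat n) * of_nat (Suc n)
           = hypergeo_coeff a b c n * (a + of_nat n) * (b + of_nat n)"
proof -
  have "c + of_nat n \<noteq> 0"
    using add_of_nat_notin_nonpos_Ints[OF assms, of n] by auto
  have "(p * A) * (q * B) / ((r * C) * (N * f)) * C * N = p * q / (r * f) * A * B"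
    if "C \<noteq> 0" "N \<noteq> 0" for p q r f A B C N :: complex
    using that by simp
  from this[OF \<open>c + of_nat n \<noteq> 0\<close> of_nat_neq_0] show ?thesis
    unfolding hypergeo_coeff_def pochhammer_Suc fact_Suc .
qed

lemma hypergeo_coeff_conv_ratio:
  "hypergeo_coeff a b c n = pochhammer a n * pochhammer b n / (pochhammer c n * pochhammer 1 n)"
  by (simp add: hypergeo_coeff_def pochhammer_fact)

text \<open>
  Domination by a binomial series: the coefficients (s)_n / n! are those of (1 - x)^{-s}. A
  value of s below 1, when it is permitted, gives an integrable bound for F at the point 1, and
  every permitted value gives convergence in the unit disc.
\<close>

lemma hypergeo_coeff_bound:
  fixes s :: real
  assumes "c \<notin> \<int>\<^sub>\<le>\<^sub>0" "s > 0" "Re (a + b - c) \<le> s"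
  obtains K where "K > 0" "\<And>n. norm (hypergeo_coeff a b c n) \<le> K * (pochhammer s n / fact n)"
proof -
  have s: "complex_of_real s \<notin> \<int>\<^sub>\<le>\<^sub>0"
    using assms(2) by (metis of_real_in_nonpos_Ints_iff nonpos_Ints_nonpos not_le)
  have "Bseq (\<lambda>n. pochhammer a n * pochhammer b n / (pochhammer c n * pochhammer (complex_of_real s) n))"
    by (rule pochhammer_ratio_Bseq[OF assms(1) s]) (use assms in simp)
  then obtain K where K: "K > 0" "\<And>n. norm (pochhammer a n * pochhammer b n / (pochhammer c n * pochhammer (complex_of_real s) n)) \<le> K"
    unfolding Bseq_def by blast
  have "norm (hypergeo_coeff a b c n) \<le> K * (pochhammer s n / fact n)" for n
  proof -
    have pos: "pochhammer s n > 0" using assms(2) by (rule pochhammer_pos)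
    have "hypergeo_coeff a b c n = pochhammer a n * pochhammer b n / (pochhammer c n * pochhammer (complex_of_real s) n)
            * (pochhammer (complex_of_real s) n / fact n)"
      using pochhammer_nonzero[OF s, of n] by (simp add: hypergeo_coeff_def)
    moreover have "norm (pochhammer (complex_of_real s) n / fact n) = pochhammer s n / fact n"
      using pos by (simp add: norm_divide pochhammer_of_real)
    ultimately show ?thesis
      using K(2)[of n] pos by (metis norm_mult mult_right_mono norm_ge_zero)
  qed
  then show ?thesis using that K by blast
qed

lemma binomial_series_pochhammer:
  fixes a w :: complex
  assumes "norm w < 1"
  shows "(\<lambda>n. pochhammer a n / fact n * w ^ n) sums (1 - w) powr (-a)"
proof -
  have "(\<lambda>n. ((-a) gchoose n) * (-w) ^ n) sums (1 + (-w)) powr (-a)"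
    by (rule gen_binomial_complex) (use assms in simp)
  moreover have "((-a) gchoose n) * (-w) ^ n = pochhammer a n / fact n * w ^ n" for n
  proof -
    have "(-1) ^ n * (-w) ^ n = w ^ n" by (simp flip: power_mult_distrib)
    then show ?thesis
      unfolding gbinomial_pochhammer by (metis mult.assoc mult.commute minus_minus times_divide_eq_right)
  qed
  ultimately show ?thesis by simp
qed

lemma binomial_series_pochhammer_real:
  fixes s x :: real
  assumes "\<bar>x\<bar> < 1"
  shows "(\<lambda>n. pochhammer s n / fact n * x ^ n) sums (1 - x) powr (-s)"
proof -
  have "(\<lambda>n. ((-s) gchoose n) * (-x) ^ n) sums (1 + (-x)) powr (-s)"
    by (rule gen_binomial_real) (use assms in simp)
  moreover have "((-s) gchoose n) * (-x) ^ n = pochhammer s n / fact n * x ^ n" for n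
  proof -
    have "(-1) ^ n * (-x) ^ n = x ^ n" by (simp flip: power_mult_distrib)
    then show ?thesis
      unfolding gbinomial_pochhammer by (metis mult.assoc mult.commute minus_minus times_divide_eq_right)
  qed
  ultimately show ?thesis by simp
qed

definition gauss_fps :: "complex \<Rightarrow> complex \<Rightarrow> complex \<Rightarrow> complex fps" where
  "gauss_fps a b c = Abs_fps (hypergeo_coeff a b c)"

lemma gauss_fps_nth [simp]: "fps_nth (gauss_fps a b c) n = hypergeo_coeff a b c n"
  by (simp add: gauss_fps_def)

lemma fps_hypergeo_eq_gauss_fps: "fps_hypergeo [a, b] [c] 1 = gauss_fps a b c"
  by (simp add: fps_eq_iff hypergeo_coeff_def)

lemma gauss_fps_norm_bound:
  fixes s :: real
  assumes "c \<notin> \<int>\<^sub>\<le>\<^sub>0" "s > 0" "Re (a + b - c) \<le> s"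
  obtains K where "K > 0" 
    "\<And>z. norm z < 1 \<Longrightarrow> summable (\<lambda>n. norm (hypergeo_coeff a b c n * z ^ n))"
    "\<And>z. norm z < 1 \<Longrightarrow> norm (eval_fps (gauss_fps a b c) z) \<le> K * (1 - norm z) powr (-s)"
proof -
  obtain K where K: "K > 0" "\<And>n. norm (hypergeo_coeff a b c n) \<le> K * (pochhammer s n / fact n)"
    by (rule hypergeo_coeff_bound[OF assms]) blast
  have le: "norm (hypergeo_coeff a b c n * z ^ n) \<le> K * (pochhammer s n / fact n * norm z ^ n)" for n z
    using mult_right_mono[OF K(2)[of n], of "norm z ^ n"] by (simp add: norm_mult norm_power mult_ac)
  have sums: "(\<lambda>n. K * (pochhammer s n / fact n * norm z ^ n)) sums (K * (1 - norm z) powr (-s))"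
    if "norm z < 1" for z :: complex
    using that by (intro sums_mult binomial_series_pochhammer_real) simp
  have summ: "summable (\<lambda>n. norm (hypergeo_coeff a b c n * z ^ n))" if "norm z < 1" for z
    by (rule summable_comparison_test'[OF sums_summable[OF sums[OF that]], of 0]) (use le in simp)
  have "norm (eval_fps (gauss_fps a b c) z) \<le> K * (1 - norm z) powr (-s)" if "norm z < 1" for z
  proof -
    have "norm (eval_fps (gauss_fps a b c) z) \<le> (\<Sum>n. norm (hypergeo_coeff a b c n * z ^ n))"
      unfolding eval_fps_def gauss_fps_nth by (rule summable_norm[OF summ[OF that]])
    also have "\<dots> \<le> K * (1 - norm z) powr (-s)"
      using suminf_le[OF le summ[OF that] sums_summable[OF sums[OF that]]] sums[OF that]
      by (simp add: sums_iff)
    finally show ?thesis .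
  qed
  with K summ show ?thesis using that by blast
qed

lemma gauss_fps_summable:
  assumes "c \<notin> \<int>\<^sub>\<le>\<^sub>0" "norm z < 1"
  shows "summable (\<lambda>n. norm (hypergeo_coeff a b c n * z ^ n))"
proof -
  have "max 1 (Re (a + b - c)) > 0" "Re (a + b - c) \<le> max 1 (Re (a + b - c))" by auto
  from gauss_fps_norm_bound[OF assms(1) this] assms(2) show ?thesis by blast
qed

lemma fps_conv_radius_geI:
  fixes F :: "complex fps"
  assumes "\<And>z. norm z < 1 \<Longrightarrow> summable (\<lambda>n. fps_nth F n * z ^ n)"
  shows "fps_conv_radius F \<ge> 1"
  unfolding fps_conv_radius_def
proof (rule conv_radius_geI_ex)
  fix r :: real assume "0 < r" "ereal r < 1"
  then show "\<exists>z. norm z = r \<and> summable (\<lambda>n. fps_nth F n * z ^ n)"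
    using assms by (intro exI[of _ "of_real r"]) auto
qed

lemma gauss_fps_conv_radius:
  assumes "c \<notin> \<int>\<^sub>\<le>\<^sub>0"
  shows "fps_conv_radius (gauss_fps a b c) \<ge> 1"
  by (rule fps_conv_radius_geI)
     (use gauss_fps_summable[OF assms] in \<open>auto intro: summable_norm_cancel\<close>)

text \<open>
  This calculus turns an identity between formal power series, checked on coefficients, into an
  identity between functions on the unit disc, with the convergence conditions discharged by
  introduction rules.
\<close>

definition disc_expansion :: "(complex \<Rightarrow> complex) \<Rightarrow> complex fps \<Rightarrow> bool" where
  "disc_expansion f G \<longleftrightarrow> fps_conv_radius G \<ge> 1 \<and> (\<forall>z. norm z < 1 \<longrightarrow> f z = eval_fps G z)"

lemma disc_expansionD: "disc_expansion f G \<Longrightarrow> norm z < 1 \<Longrightarrow> f z = eval_fps G z"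
  by (simp add: disc_expansion_def)

lemma disc_expansion_norm_less:
  assumes "disc_expansion f G" "norm z < 1"
  shows "ereal (norm z) < fps_conv_radius G"
proof -
  have "ereal (norm z) < 1" using assms(2) by simp
  also have "1 \<le> fps_conv_radius G" using assms(1) by (simp add: disc_expansion_def)
  finally show ?thesis .
qed

named_theorems disc_expansion_intros

lemma disc_expansion_const [disc_expansion_intros]: "disc_expansion (\<lambda>_. k) (fps_const k)"
  by (simp add: disc_expansion_def)

lemma disc_expansion_X [disc_expansion_intros]: "disc_expansion (\<lambda>z. z) fps_X"
  by (simp add: disc_expansion_def)

lemma disc_expansion_add [disc_expansion_intros]:
  assumes "disc_expansion f G" "disc_expansion g H"
  shows "disc_expansion (\<lambda>z. f z + g z) (G + H)"
  unfolding disc_expansion_def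
proof (intro conjI allI impI)
  show "1 \<le> fps_conv_radius (G + H)"
    by (rule order.trans[OF _ fps_conv_radius_add]) (use assms in \<open>simp add: disc_expansion_def\<close>)
  show "f z + g z = eval_fps (G + H) z" if "norm z < 1" for z
    using assms[THEN disc_expansionD, OF that] assms[THEN disc_expansion_norm_less, OF that]
    by (simp add: eval_fps_add)
qed

lemma disc_expansion_diff [disc_expansion_intros]:
  assumes "disc_expansion f G" "disc_expansion g H"
  shows "disc_expansion (\<lambda>z. f z - g z) (G - H)"
  unfolding disc_expansion_def
proof (intro conjI allI impI)
  show "1 \<le> fps_conv_radius (G - H)"
    by (rule order.trans[OF _ fps_conv_radius_diff]) (use assms in \<open>simp add: disc_expansion_def\<close>)
  show "f z - g z = eval_fps (G - H) z" if "norm z < 1" for z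
    using assms[THEN disc_expansionD, OF that] assms[THEN disc_expansion_norm_less, OF that]
    by (simp add: eval_fps_diff)
qed

lemma disc_expansion_mult [disc_expansion_intros]:
  assumes "disc_expansion f G" "disc_expansion g H"
  shows "disc_expansion (\<lambda>z. f z * g z) (G * H)"
  unfolding disc_expansion_def
proof (intro conjI allI impI)
  show "1 \<le> fps_conv_radius (G * H)"
    by (rule order.trans[OF _ fps_conv_radius_mult]) (use assms in \<open>simp add: disc_expansion_def\<close>)
  show "f z * g z = eval_fps (G * H) z" if "norm z < 1" for z
    using assms[THEN disc_expansionD, OF that] assms[THEN disc_expansion_norm_less, OF that]
    by (simp add: eval_fps_mult)
qed

lemma disc_expansion_deriv [disc_expansion_intros]:
  assumes "disc_expansion f G"
  shows "disc_expansion (deriv f) (fps_deriv G)"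
  unfolding disc_expansion_def
proof (intro conjI allI impI)
  show "1 \<le> fps_conv_radius (fps_deriv G)"
    by (rule order.trans[OF _ fps_conv_radius_deriv]) (use assms in \<open>simp add: disc_expansion_def\<close>)
  fix z :: complex assume z: "norm z < 1"
  have "eventually (\<lambda>w. w \<in> ball 0 1) (nhds z)"
    by (rule eventually_nhds_in_open) (use z in auto)
  then have "eventually (\<lambda>w. f w = eval_fps G w) (nhds z)"
    by eventually_elim (use disc_expansionD[OF assms] in auto)
  then have "deriv f z = deriv (eval_fps G) z" by (rule deriv_cong_ev) simp
  also have "\<dots> = eval_fps (fps_deriv G) z"
    by (rule eval_fps_deriv[symmetric]) (rule disc_expansion_norm_less[OF assms z])
  finally show "deriv f z = eval_fps (fps_deriv G) z" .
qed

lemma disc_expansion_gauss_fps: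
  assumes "c \<notin> \<int>\<^sub>\<le>\<^sub>0"
  shows "disc_expansion (eval_fps (gauss_fps a b c)) (gauss_fps a b c)"
  by (simp add: disc_expansion_def gauss_fps_conv_radius[OF assms])



section \<open>Gauss's summation theorem and the limit at 1\<close>

lemma hypergeo_coeff_raise_c:
  assumes "c \<notin> \<int>\<^sub>\<le>\<^sub>0"
  shows "hypergeo_coeff a b (c + 1) n * (c + of_nat n) = c * hypergeo_coeff a b c n"
proof -
  have nz: "c \<noteq> 0" "pochhammer c n \<noteq> 0" "c + of_nat n \<noteq> 0"
    using assms pochhammer_nonzero[OF assms] add_of_nat_notin_nonpos_Ints[OF assms, of n] by auto
  have "c * pochhammer (c + 1) n = pochhammer c n * (c + of_nat n)"
    by (metis pochhammer_rec pochhammer_Suc)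
  then have "pochhammer (c + 1) n = pochhammer c n * (c + of_nat n) / c"
    using nz by (simp add: field_simps)
  then show ?thesis using nz by (simp add: hypergeo_coeff_def)
qed

text \<open>
  In terms of functions this is (1 - z) F' + (c - a - b) F = (c - a)(c - b)/c F(a, b; c + 1).
  It serves twice. Its first two terms telescope, which gives the recursion in c for the value at 1.
  Its left-hand side is also, up to a correction that vanishes as z tends to 1 from below, the
  boundary term of the moment recurrence; the right-hand side shows that this has a limit although
  F itself may be unbounded.
\<close>

lemma hypergeo_coeff_contiguous_c:
  assumes c: "c \<notin> \<int>\<^sub>\<le>\<^sub>0"
  shows "of_nat (Suc n) * hypergeo_coeff a b c (Suc n) - of_nat n * hypergeo_coeff a b c n
           + (c - a - b) * hypergeo_coeff a b c n
         = (c - a) * (c - b) / c * hypergeo_coeff a b (c + 1) n"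
    (is "?L = ?R")
proof -
  let ?f = "hypergeo_coeff a b c n"
  have nz: "c \<noteq> 0" "c + of_nat n \<noteq> 0"
    using c add_of_nat_notin_nonpos_Ints[OF c, of n] by auto
  have "?L * (c + of_nat n) = hypergeo_coeff a b c (Suc n) * (c + of_nat n) * of_nat (Suc n)
         + (c - a - b - of_nat n) * ?f * (c + of_nat n)"
    by (simp add: algebra_simps)
  also have "\<dots> = (c - a) * (c - b) * ?f"
    unfolding hypergeo_coeff_Suc[OF c] by (simp add: algebra_simps)
  also have "\<dots> = (c - a) * (c - b) / c * (hypergeo_coeff a b (c + 1) n * (c + of_nat n))"
    unfolding hypergeo_coeff_raise_c[OF c] using nz by simp
  also have "\<dots> = ?R * (c + of_nat n)"
    by simp
  finally show ?thesis using mult_right_cancel[OF nz(2)] by blast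
qed

lemma hypergeo_coeff_partial_sum:
  assumes c: "c \<notin> \<int>\<^sub>\<le>\<^sub>0"
  shows "(c - a - b) * (\<Sum>k<n. hypergeo_coeff a b c k) + of_nat n * hypergeo_coeff a b c n
         = (c - a) * (c - b) / c * (\<Sum>k<n. hypergeo_coeff a b (c + 1) k)"
proof (induction n)
  case (Suc n)
  have add: "D * (S + f) + N' * f' = R * (S' + g)"
    if "D * S + N * f = R * S'" "N' * f' - N * f + D * f = R * g" for D S f N' f' R S' g N :: complex
  proof -
    have "D * (S + f) + N' * f' = (D * S + N * f) + (N' * f' - N * f + D * f)"
      by (simp add: algebra_simps)
    then show ?thesis unfolding that by (simp add: distrib_left)
  qed
  show ?case
    unfolding sum.lessThan_Suc by (rule add[OF Suc.IH hypergeo_coeff_contiguous_c[OF c]])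
qed simp

lemma hypergeo_coeff_summable:
  assumes "c \<notin> \<int>\<^sub>\<le>\<^sub>0" "Re (c - a - b) > 0"
  shows "summable (\<lambda>n. norm (hypergeo_coeff a b c n))"
proof -
  obtain K where K: "K > 0" "\<And>n. n \<ge> 1 \<Longrightarrow>
    norm (pochhammer a (Suc n) * pochhammer b (Suc n) / (pochhammer c (Suc n) * pochhammer 1 (Suc n)))
      \<le> K * real n powr Re (a + b - c - 1)"
    by (rule pochhammer_ratio_bound[OF assms(1) one_notin_nonpos_Ints, of a b]) blast
  have "summable (\<lambda>n. K * real n powr Re (a + b - c - 1))"
    using assms(2) by (intro summable_mult) (simp add: summable_real_powr_iff)
  then have "summable (\<lambda>n. norm (hypergeo_coeff a b c (Suc n)))"
    by (rule summable_comparison_test'[where N = 1])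
       (use K in \<open>simp add: hypergeo_coeff_conv_ratio del: pochhammer_Suc\<close>)
  then show ?thesis by (subst (asm) summable_Suc_iff)
qed

text \<open>
  The coefficient f_n is O(n^{a+b-c-1}), so n f_n is O(n^{a+b-c}). Shifting all parameters by one
  absorbs the factor n.
\<close>

lemma of_nat_mult_hypergeo_coeff_tendsto_0:
  assumes "c \<notin> \<int>\<^sub>\<le>\<^sub>0" "Re (c - a - b) > 0"
  shows "(\<lambda>n. of_nat n * hypergeo_coeff a b c n) \<longlonglongrightarrow> 0"
proof -
  have c1: "c + 1 \<notin> \<int>\<^sub>\<le>\<^sub>0" using add_of_nat_notin_nonpos_Ints[OF assms(1), of 1] by simp
  have nz: "c \<noteq> 0" using assms(1) by auto
  have "(\<lambda>n. pochhammer (a + 1) n * pochhammer (b + 1) n / (pochhammer (c + 1) n * pochhammer 1 n)) \<longlonglongrightarrow> 0"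
    by (rule pochhammer_ratio_tendsto_0[OF c1 one_notin_nonpos_Ints]) (use assms(2) in simp)
  then have "(\<lambda>n. a * b / c * (pochhammer (a + 1) n * pochhammer (b + 1) n / (pochhammer (c + 1) n * pochhammer 1 n)))
       \<longlonglongrightarrow> 0"
    by (rule tendsto_mult_right_zero)
  also have "(\<lambda>n. a * b / c * (pochhammer (a + 1) n * pochhammer (b + 1) n / (pochhammer (c + 1) n * pochhammer 1 n)))
      = (\<lambda>n. of_nat (Suc n) * hypergeo_coeff a b c (Suc n))"
  proof
    fix n
    have "of_nat (Suc n) * (p * q / (r * (of_nat (Suc n) * f))) = p * q / (r * f)" for p q r f :: complex
      using of_nat_neq_0[of n, where 'a = complex] by (simp del: of_nat_Suc)
    then show "a * b / c * (pochhammer (a + 1) n * pochhammer (b + 1) n / (pochhammer (c + 1) n * pochhammer 1 n))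
      = of_nat (Suc n) * hypergeo_coeff a b c (Suc n)"
      unfolding hypergeo_coeff_def pochhammer_rec fact_Suc pochhammer_fact[symmetric]
      by (simp add: mult_ac del: of_nat_Suc)
  qed
  finally show ?thesis by (rule LIMSEQ_imp_Suc)
qed

lemma tendsto_suminf_dominated:
  fixes f :: "nat \<Rightarrow> 'b \<Rightarrow> complex"
  assumes "\<And>k. (f k \<longlongrightarrow> l k) F" "eventually (\<lambda>x. \<forall>k. norm (f k x) \<le> M k) F" "summable M" "F \<noteq> bot"
  shows "((\<lambda>x. \<Sum>k. f k x) \<longlongrightarrow> (\<Sum>k. l k)) F"
proof -
  have "eventually (\<lambda>(k,x). norm (f k x) \<le> M k) (at_top \<times>\<^sub>F F)"
    by (rule eventually_mono[OF eventually_prodI[OF eventually_True assms(2)]]) auto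
  then show ?thesis using tannerys_theorem[where a = f and b = l and F = F and M = M] assms by blast
qed

lemma norm_pochhammer_ge:
  assumes "0 < r" "r \<le> Re z"
  shows "norm (pochhammer (complex_of_real r) n) \<le> norm (pochhammer z n)"
proof (induction n)
  case (Suc n)
  have "norm (complex_of_real r + of_nat n) = r + of_nat n"
    using assms(1) by (metis norm_of_real of_real_add of_real_of_nat_eq abs_of_pos add_pos_nonneg of_nat_0_le_iff)
  also have "\<dots> \<le> Re (z + of_nat n)" using assms(2) by simp
  also have "\<dots> \<le> norm (z + of_nat n)" by (rule complex_Re_le_cmod)
  finally show ?case
    using Suc.IH by (simp add: pochhammer_Suc norm_mult mult_mono)
qed simp

lemma hypergeo_coeff_c_tendsto:
  "(\<lambda>n. hypergeo_coeff a b (c + of_nat n) k) \<longlonglongrightarrow> (if k = 0 then 1 else 0)"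
proof -
  have inf: "filterlim (\<lambda>n. (c + of_nat i) + complex_of_nat n) at_infinity sequentially" for i
    by (rule tendsto_add_filterlim_at_infinity[OF tendsto_const tendsto_of_nat])
  have fac: "(\<lambda>n. (a + of_nat i) * (b + of_nat i) / ((c + of_nat i) + of_nat n) / of_nat (Suc i)) \<longlonglongrightarrow> 0 / of_nat (Suc i)"
    for i
    by (intro tendsto_divide tendsto_divide_0[OF tendsto_const] inf tendsto_const of_nat_neq_0)
  have "(\<lambda>n. \<Prod>i<k. (a + of_nat i) * (b + of_nat i) / ((c + of_nat i) + of_nat n) / of_nat (Suc i))
          \<longlonglongrightarrow> (\<Prod>i<k. 0 / of_nat (Suc i))"
    by (intro tendsto_prod fac)
  moreover have "(\<Prod>i<k. (a + of_nat i) * (b + of_nat i) / ((c + of_nat i) + of_nat n) / of_nat (Suc i))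
      = hypergeo_coeff a b (c + of_nat n) k" for n
    by (induction k) (simp_all add: hypergeo_coeff_def pochhammer_Suc mult_ac add_ac)
  moreover have "(\<Prod>i<k. 0 / of_nat (Suc i)) = (if k = 0 then 1 else (0::complex))"
    by (cases k) auto
  ultimately show ?thesis by simp
qed

text \<open>
  As c moves to the right every coefficient except the first tends to 0. Once Re (c + n) is at
  least a positive real r > Re (a + b), the symbols (c + n)_k dominate (r)_k, so the convergent
  series with parameter r is a uniform majorant.
\<close>

lemma hypergeo_sum_c_tendsto_1:
  "(\<lambda>n. \<Sum>k. hypergeo_coeff a b (c + of_nat n) k) \<longlonglongrightarrow> 1"
proof -
  obtain N :: nat where N: "real N > max 0 (Re (a + b)) - Re c"
    using reals_Archimedean2 by blast
  \<comment> \<open>r > Re (a + b) makes the majorant summable, and r > 0 makes (r)_k a lower bound for the denominators.\<close>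
  define r where "r = Re c + real N"
  have r: "r > 0" "r > Re (a + b)" using N by (auto simp: r_def)
  have r': "complex_of_real r \<notin> \<int>\<^sub>\<le>\<^sub>0"
    using r(1) by (metis of_real_in_nonpos_Ints_iff nonpos_Ints_nonpos not_le)
  have "summable (\<lambda>k. norm (hypergeo_coeff a b (of_real r) k))"
    by (rule hypergeo_coeff_summable[OF r']) (use r in simp)
  moreover have "norm (hypergeo_coeff a b (c + of_nat n) k) \<le> norm (hypergeo_coeff a b (of_real r) k)"
    if "n \<ge> N" for n k
  proof -
    have "norm (pochhammer (complex_of_real r) k) \<le> norm (pochhammer (c + of_nat n) k)"
      by (rule norm_pochhammer_ge[OF r(1)]) (use that in \<open>simp add: r_def\<close>)
    moreover have "norm (pochhammer (complex_of_real r) k) > 0"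
      using pochhammer_nonzero[OF r'] by simp
    ultimately show ?thesis
      unfolding hypergeo_coeff_def norm_divide norm_mult
      by (intro divide_left_mono mult_right_mono mult_pos_pos) (auto intro: order.strict_trans2)
  qed
  then have "eventually (\<lambda>n. \<forall>k. norm (hypergeo_coeff a b (c + of_nat n) k) \<le> norm (hypergeo_coeff a b (of_real r) k)) sequentially"
    by (intro eventually_sequentiallyI[of N]) blast
  ultimately have "(\<lambda>n. \<Sum>k. hypergeo_coeff a b (c + of_nat n) k) \<longlonglongrightarrow> (\<Sum>k. if k = 0 then 1 else 0)"
    by (intro tendsto_suminf_dominated hypergeo_coeff_c_tendsto) auto
  also have "(\<Sum>k. if k = 0 then 1 else 0) = (1::complex)"
    using sums_unique[OF sums_single[of 0 "\<lambda>_. 1::complex"]] by simp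
  finally show ?thesis .
qed

text \<open>
  Gauss's theorem. The telescoped contiguous relation gives
  (c - a - b) S(c) = (c - a)(c - b)/c S(c + 1). Iterating it n times leaves a quotient of Pochhammer
  symbols whose exponents balance exactly, so that it converges to the Gamma quotient, times
  S(c + n), which tends to 1.
\<close>

theorem gauss_summation:
  assumes c: "c \<notin> \<int>\<^sub>\<le>\<^sub>0" and re: "Re (c - a - b) > 0"
  shows "(\<lambda>n. hypergeo_coeff a b c n) sums
           (Gamma c * Gamma (c - a - b) * rGamma (c - a) * rGamma (c - b))"
proof -
  define S where "S = (\<lambda>n. \<Sum>k. hypergeo_coeff a b (c + of_nat n) k)"
  have cn: "c + of_nat n \<notin> \<int>\<^sub>\<le>\<^sub>0" for n by (rule add_of_nat_notin_nonpos_Ints[OF c])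
  have ren: "Re (c + of_nat n - a - b) > 0" for n using re by simp
  have sums: "(\<lambda>k. hypergeo_coeff a b (c + of_nat n) k) sums S n" for n
    unfolding S_def
    by (rule summable_sums[OF summable_norm_cancel[OF hypergeo_coeff_summable[OF cn ren]]])
  have step: "(c + of_nat n - a - b) * S n = (c + of_nat n - a) * (c + of_nat n - b) / (c + of_nat n) * S (Suc n)" for n
  proof (rule LIMSEQ_unique)
    show "(\<lambda>m. (c + of_nat n - a - b) * (\<Sum>k<m. hypergeo_coeff a b (c + of_nat n) k)
             + of_nat m * hypergeo_coeff a b (c + of_nat n) m) \<longlonglongrightarrow> (c + of_nat n - a - b) * S n"
      using tendsto_add[OF tendsto_mult[OF tendsto_const sums[unfolded sums_def]]
          of_nat_mult_hypergeo_coeff_tendsto_0[OF cn ren]] by simp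
    show "(\<lambda>m. (c + of_nat n - a - b) * (\<Sum>k<m. hypergeo_coeff a b (c + of_nat n) k)
             + of_nat m * hypergeo_coeff a b (c + of_nat n) m)
        \<longlonglongrightarrow> (c + of_nat n - a) * (c + of_nat n - b) / (c + of_nat n) * S (Suc n)"
      unfolding hypergeo_coeff_partial_sum[OF cn]
      using sums[of "Suc n"] unfolding sums_def
      by (intro tendsto_mult tendsto_const) (simp add: add_ac)
  qed
  have poch: "pochhammer c n * pochhammer (c - a - b) n * S 0 = pochhammer (c - a) n * pochhammer (c - b) n * S n" for n
  proof (induction n)
    case (Suc n)
    have "pochhammer c (Suc n) * pochhammer (c - a - b) (Suc n) * S 0
        = (c + of_nat n) * (c + of_nat n - a - b) * (pochhammer c n * pochhammer (c - a - b) n * S 0)"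
      by (simp add: pochhammer_Suc algebra_simps)
    also have "\<dots> = pochhammer (c - a) n * pochhammer (c - b) n * (c + of_nat n) * ((c + of_nat n - a - b) * S n)"
      unfolding Suc.IH by (simp only: mult_ac)
    also have "\<dots> = pochhammer (c - a) n * pochhammer (c - b) n * ((c + of_nat n - a) * (c + of_nat n - b)) * S (Suc n)"
    proof -
      have "c + of_nat n \<noteq> 0" using cn[of n] by auto
      then show ?thesis unfolding step by simp
    qed
    also have "\<dots> = pochhammer (c - a) (Suc n) * pochhammer (c - b) (Suc n) * S (Suc n)"
      by (simp add: pochhammer_Suc algebra_simps)
    finally show ?case .
  qed simp
  have d: "c - a - b \<notin> \<int>\<^sub>\<le>\<^sub>0"
    using re by (rule notin_nonpos_Ints_if_Re_pos)
  define q where "q = (\<lambda>n. pochhammer (c - a) n * pochhammer (c - b) n / (pochhammer c n * pochhammer (c - a - b) n))"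
  obtain Q where Q: "Q \<longlonglongrightarrow> rGamma (c - a) * rGamma (c - b) * Gamma c * Gamma (c - a - b)"
    and qQ: "\<And>n. n \<ge> 1 \<Longrightarrow> q (Suc n) = Q n * exp ((c - a + (c - b) - c - (c - a - b)) * of_real (ln (of_nat n)))"
    unfolding q_def by (rule pochhammer_ratio_asymptotic[OF c d, of "c - a" "c - b"]) blast
  have "eventually (\<lambda>n. Q n = q (Suc n)) sequentially"
    by (intro eventually_sequentiallyI[of 1]) (simp add: qQ)
  then have "(\<lambda>n. q (Suc n)) \<longlonglongrightarrow> rGamma (c - a) * rGamma (c - b) * Gamma c * Gamma (c - a - b)"
    by (rule Lim_transform_eventually[OF Q])
  then have "q \<longlonglongrightarrow> rGamma (c - a) * rGamma (c - b) * Gamma c * Gamma (c - a - b)"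
    by (rule LIMSEQ_imp_Suc)
  moreover have "S \<longlonglongrightarrow> 1" unfolding S_def by (rule hypergeo_sum_c_tendsto_1)
  ultimately have "(\<lambda>n. q n * S n) \<longlonglongrightarrow> rGamma (c - a) * rGamma (c - b) * Gamma c * Gamma (c - a - b) * 1"
    by (rule tendsto_mult)
  moreover have "q n * S n = S 0" for n
    using poch[of n] pochhammer_nonzero[OF c, of n] pochhammer_nonzero[OF d, of n]
    unfolding q_def times_divide_eq_left by (simp add: nonzero_divide_eq_eq mult_ac)
  ultimately have "S 0 = rGamma (c - a) * rGamma (c - b) * Gamma c * Gamma (c - a - b)"
    by (simp add: LIMSEQ_const_iff)
  then show ?thesis using sums[of 0] by (simp add: mult_ac)
qed

lemma gauss_fps_contiguous_c:
  assumes c: "c \<notin> \<int>\<^sub>\<le>\<^sub>0"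
  shows "(1 - fps_X) * fps_deriv (gauss_fps a b c) + fps_const (c - a - b) * gauss_fps a b c
           = fps_const ((c - a) * (c - b) / c) * gauss_fps a b (c + 1)"
proof (rule fps_ext)
  fix n
  have "fps_nth (fps_X * fps_deriv (gauss_fps a b c)) n = of_nat n * hypergeo_coeff a b c n"
    by (cases n) auto
  then show "fps_nth ((1 - fps_X) * fps_deriv (gauss_fps a b c) + fps_const (c - a - b) * gauss_fps a b c) n
           = fps_nth (fps_const ((c - a) * (c - b) / c) * gauss_fps a b (c + 1)) n"
    using hypergeo_coeff_contiguous_c[OF c, of n a b]
    by (simp add: left_diff_distrib fps_add_nth fps_sub_nth)
qed

text \<open>
  Only Re (c - a - b) > -1 is available, so F need not have a limit at 1. The combination on the
  left equals (c - a)(c - b)/c F(a, b; c + 1), and raising c by one brings Gauss's theorem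
  into range. The Gamma factors combine by the functional equation; with the reciprocal Gamma
  function this remains correct when c - a or c - b is a non-positive integer.
\<close>

lemma E_plus_limit:
  assumes c: "c \<notin> \<int>\<^sub>\<le>\<^sub>0" and re: "Re (c - a - b) > -1" and f: "disc_expansion f (gauss_fps a b c)"
  shows "((\<lambda>x. (1 - of_real x) * deriv f (of_real x) + (c - a - b) * f (of_real x)) \<longlongrightarrow> E_plus a b c)
           (at_left (1::real))"
proof -
  let ?H = "gauss_fps a b (c + 1)"
  have nz: "c \<noteq> 0" using c by auto
  have c1: "c + 1 \<notin> \<int>\<^sub>\<le>\<^sub>0" using add_of_nat_notin_nonpos_Ints[OF c, of 1] by simp
  have re1: "Re (c + 1 - a - b) > 0" using re by simp
  have ev: "eventually (\<lambda>x::real. x \<in> {0<..<1}) (at_left 1)"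
    by (rule eventually_at_leftI[of 0]) auto
  have "((\<lambda>x. \<Sum>k. hypergeo_coeff a b (c + 1) k * of_real x ^ k) \<longlongrightarrow> (\<Sum>k. hypergeo_coeff a b (c + 1) k * of_real 1 ^ k)) (at_left (1::real))"
  proof (rule tendsto_suminf_dominated)
    show "eventually (\<lambda>x. \<forall>k. norm (hypergeo_coeff a b (c + 1) k * of_real x ^ k) \<le> norm (hypergeo_coeff a b (c + 1) k)) (at_left (1::real))"
      using ev
    proof eventually_elim
      case (elim x)
      then show ?case
        by (auto simp: norm_mult norm_power intro!: mult_left_le power_le_one)
    qed
    show "summable (\<lambda>k. norm (hypergeo_coeff a b (c + 1) k))"
      by (rule hypergeo_coeff_summable[OF c1 re1])
  qed (intro tendsto_intros | simp)+
  also have "(\<Sum>k. hypergeo_coeff a b (c + 1) k * of_real 1 ^ k)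
      = Gamma (c + 1) * Gamma (c + 1 - a - b) * rGamma (c + 1 - a) * rGamma (c + 1 - b)"
    using sums_unique[OF gauss_summation[OF c1 re1]] by simp
  finally have lim: "((\<lambda>x. (c - a) * (c - b) / c * eval_fps ?H (of_real x)) \<longlongrightarrow>
     (c - a) * (c - b) / c * (Gamma (c + 1) * Gamma (c + 1 - a - b) * rGamma (c + 1 - a) * rGamma (c + 1 - b)))
        (at_left (1::real))"
    unfolding eval_fps_def gauss_fps_nth by (intro tendsto_mult tendsto_const)
  have "(c - a) * (c - b) / c * (Gamma (c + 1) * Gamma (c + 1 - a - b) * rGamma (c + 1 - a) * rGamma (c + 1 - b))
     = E_plus a b c"
  proof -
    have "Gamma (c + 1) = c * Gamma c" using c by (rule Gamma_plus1)
    moreover have "(c - a) * rGamma (c + 1 - a) = rGamma (c - a)"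
      using rGamma_plus1[of "c - a"] by (simp add: algebra_simps)
    moreover have "(c - b) * rGamma (c + 1 - b) = rGamma (c - b)"
      using rGamma_plus1[of "c - b"] by (simp add: algebra_simps)
    moreover have "Gamma (c + 1 - a - b) = Gamma (c - a - b + 1)"
      by (rule arg_cong[of _ _ Gamma]) simp
    moreover have "u * v / c * ((c * g) * h * p * q) = g * h * (u * p) * (v * q)" for u v g h p q
      using nz by simp
    ultimately show ?thesis unfolding E_plus_def by simp
  qed
  moreover have "eventually (\<lambda>x. (c - a) * (c - b) / c * eval_fps ?H (of_real x)
       = (1 - of_real x) * deriv f (of_real x) + (c - a - b) * f (of_real x)) (at_left (1::real))"
    using ev
  proof eventually_elim
    case (elim x)
    have "disc_expansion (\<lambda>z. (1 - z) * deriv f z + (c - a - b) * f z)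
        (fps_const ((c - a) * (c - b) / c) * ?H)"
      unfolding gauss_fps_contiguous_c[OF c, symmetric] fps_const_1_eq_1[symmetric]
      by (intro disc_expansion_intros f)
    from disc_expansionD[OF this, of "of_real x"]
      disc_expansionD[OF disc_expansion_mult[OF disc_expansion_const disc_expansion_gauss_fps[OF c1, of a b]], of "of_real x"]
    show ?case using elim by simp
  qed
  ultimately show ?thesis using Lim_transform_eventually[OF lim] by simp
qed



section \<open>The complex Beta integral\<close>

lemma continuous_on_mult_ln: "continuous_on {0..1} (\<lambda>t::real. t * ln t)"
proof -
  have "continuous (at t within {0..1}) (\<lambda>t::real. t * ln t)" if "t \<in> {0..1}" for t
  proof (cases "t = 0")
    case True
    have "((\<lambda>x::real. - (ln x / x)) \<longlongrightarrow> - 0) at_top"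
      by (intro tendsto_minus ln_x_over_x_tendsto_0)
    moreover have "eventually (\<lambda>x::real. - (ln x / x) = inverse x * ln (inverse x)) at_top"
      using eventually_gt_at_top[of 0]
      by eventually_elim (simp add: ln_inverse ln_div field_simps)
    ultimately have "((\<lambda>x::real. inverse x * ln (inverse x)) \<longlongrightarrow> - 0) at_top"
      by (rule Lim_transform_eventually)
    then have "((\<lambda>x::real. x * ln x) \<longlongrightarrow> 0) (at_right 0)"
      by (simp add: filterlim_at_right_to_top)
    moreover have "at (0::real) within {0..1} = at_right 0"
      by (rule at_within_Icc_at_right) simp
    ultimately show ?thesis using True by (simp add: continuous_within)
  next
    case False
    then show ?thesis using that by (intro continuous_intros) auto
  qed
  then show ?thesis by (simp add: continuous_on_eq_continuous_within)
qed

lemma continuous_on_powr_unit: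
  fixes \<phi> :: "'a::topological_space \<Rightarrow> real"
  assumes "continuous_on A \<phi>" "\<And>t. t \<in> A \<Longrightarrow> 0 \<le> \<phi> t" "continuous_on A h" "\<And>t. t \<in> A \<Longrightarrow> Re (h t) > 0"
  shows "continuous_on A (\<lambda>t. complex_of_real (\<phi> t) powr h t)"
  by (rule continuous_on_powr_complex) (use assms in \<open>auto intro!: continuous_intros\<close>)

text \<open>
  For Re x > 2 the derivative \<phi>^{x-1} ln \<phi> of the kernel is a product of the continuous
  factors \<phi>^{x-2} and \<phi> ln \<phi>, so the Leibniz rule applies on the closed interval, zeros of \<phi>
  included.
\<close>

lemma holomorphic_powr_kernel_integral:
  fixes \<phi> :: "real \<Rightarrow> real" and g :: "real \<Rightarrow> complex"
  assumes \<phi>: "continuous_on {0..1} \<phi>" "\<And>t. t \<in> {0..1} \<Longrightarrow> \<phi> t \<in> {0..1}"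
    and g: "continuous_on {0..1} g"
  shows "(\<lambda>x. integral {0..1} (\<lambda>t. of_real (\<phi> t) powr (x - 1) * g t)) holomorphic_on {x. Re x > 2}"
proof -
  let ?U = "{x. Re x > 2}"
  let ?fx = "\<lambda>x t. of_real (\<phi> t) powr (x - 2) * of_real (\<phi> t * ln (\<phi> t)) * g t"
  have 1: "((\<lambda>x. of_real (\<phi> t) powr (x - 1) * g t) has_field_derivative ?fx x t) (at x within ?U)"
    if "x \<in> ?U" "t \<in> cbox 0 1" for x t
  proof (cases "\<phi> t = 0")
    case False
    with \<phi>(2)[of t] that have pos: "\<phi> t > 0" by auto
    have eq: "of_real (\<phi> t) powr (x - 1) = of_real (\<phi> t) powr (x - 2) * of_real (\<phi> t)"
      using powr_add[of "complex_of_real (\<phi> t)" "x - 2" 1] pos by simp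
    have "((\<lambda>x. of_real (\<phi> t) powr (x - 1)) has_field_derivative
        of_real (\<phi> t) powr (x - 1) * of_real (ln (\<phi> t))) (at x within ?U)"
      using pos unfolding powr_def by (auto intro!: derivative_eq_intros simp: Ln_of_real)
    from DERIV_cmult_right[OF this, of "g t"]
    have "((\<lambda>x. of_real (\<phi> t) powr (x - 1) * g t) has_field_derivative
        of_real (\<phi> t) powr (x - 1) * of_real (ln (\<phi> t)) * g t) (at x within ?U)" .
    moreover have "of_real (\<phi> t) powr (x - 1) * of_real (ln (\<phi> t)) * g t = ?fx x t"
      unfolding eq by simp
    ultimately show ?thesis by simp
  qed simp
  have 2: "(\<lambda>t. of_real (\<phi> t) powr (x - 1) * g t) integrable_on cbox 0 1" if "x \<in> ?U" for x
  proof -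
    have "continuous_on {0..1} (\<lambda>t. of_real (\<phi> t) powr (x - 1))"
      by (rule continuous_on_powr_unit[OF \<phi>(1) _ continuous_on_const]) (use that \<phi>(2) in auto)
    from integrable_continuous_real[OF continuous_on_mult[OF this g]] show ?thesis by simp
  qed
  have snd: "continuous_on (?U \<times> {0..1}) (snd :: complex \<times> real \<Rightarrow> real)"
      "snd ` (?U \<times> {0..1::real}) \<subseteq> {0..1}"
    by (auto intro: continuous_intros)
  have \<phi>snd: "continuous_on (?U \<times> {0..1}) (\<lambda>p. \<phi> (snd p))"
    by (rule continuous_on_compose2[OF \<phi>(1) snd])
  have gsnd: "continuous_on (?U \<times> {0..1}) (\<lambda>p. g (snd p))"
    by (rule continuous_on_compose2[OF g snd])
  have lnsnd: "continuous_on (?U \<times> {0..1}) (\<lambda>p. \<phi> (snd p) * ln (\<phi> (snd p)))"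
    by (rule continuous_on_compose2[OF continuous_on_mult_ln \<phi>snd]) (use \<phi>(2) in auto)
  have powsnd: "continuous_on (?U \<times> {0..1}) (\<lambda>p. of_real (\<phi> (snd p)) powr (fst p - 2))"
  proof (rule continuous_on_powr_unit[OF \<phi>snd])
    show "continuous_on (?U \<times> {0..1}) (\<lambda>p::complex \<times> real. fst p - 2)"
      by (intro continuous_on_diff continuous_on_fst continuous_on_id continuous_on_const)
    show "0 \<le> \<phi> (snd p)" if "p \<in> ?U \<times> {0..1}" for p
      using \<phi>(2)[of "snd p"] that by auto
    show "Re (fst p - 2) > 0" if "p \<in> ?U \<times> {0..1::real}" for p
      using that by auto
  qed
  have "continuous_on (?U \<times> cbox 0 1) (\<lambda>(x, t). ?fx x t)"
    using continuous_on_mult[OF continuous_on_mult[OF powsnd continuous_on_of_real[OF lnsnd]] gsnd]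
    unfolding case_prod_unfold by simp
  from leibniz_rule_holomorphic[OF 1 2 this]
  show ?thesis by (simp add: convex_halfspace_Re_gt)
qed

lemma integral_powr_unit_has_integral:
  assumes "Re x > 1" "Re y > 1"
  shows "((\<lambda>t. of_real t powr (x - 1) * of_real (1 - t) powr (y - 1)) has_integral
            integral {0..1} (\<lambda>t. of_real t powr (x - 1) * of_real (1 - t) powr (y - 1))) {0..1::real}"
  by (intro integrable_integral integrable_continuous_real continuous_on_mult continuous_on_powr_unit)
     (use assms in \<open>auto intro!: continuous_intros\<close>)

lemma eq_on_halfplane:
  assumes f: "f holomorphic_on {z. Re z > 2}" and g: "g holomorphic_on {z. Re z > 2}"
    and eq: "\<And>x::real. x > 2 \<Longrightarrow> f (of_real x) = g (of_real x)" and "Re z > 2"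
  shows "f z = g z"
proof -
  have "(3::complex) islimpt (of_real ` {2::real<..})"
    unfolding islimpt_approachable
  proof (intro allI impI)
    fix e :: real assume "e > 0"
    then show "\<exists>x'\<in>of_real ` {2::real<..}. x' \<noteq> (3::complex) \<and> dist x' 3 < e"
      by (intro bexI[of _ "of_real (3 + e / 2)"] imageI) (auto simp: dist_norm)
  qed
  have "f z - g z = 0"
  proof (rule analytic_continuation[where f = "\<lambda>z. f z - g z" and S = "{z. Re z > 2}"])
    show "(\<lambda>z. f z - g z) holomorphic_on {z. Re z > 2}"
      by (intro holomorphic_intros f g)
    show "(3::complex) islimpt (of_real ` {2::real<..})" by fact
    show "connected {z. Re z > 2}" by (intro convex_connected convex_halfspace_Re_gt)
    show "\<And>z. z \<in> of_real ` {2::real<..} \<Longrightarrow> f z - g z = 0" using eq by auto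
  qed (use \<open>Re z > 2\<close> in \<open>auto simp: open_halfspace_Re_gt\<close>)
  then show ?thesis by simp
qed

text \<open>
  The integral and the Beta function are holomorphic in each parameter and agree for real
  parameters; the identity theorem is applied first in x and then in y. The restriction
  to Re > 2 costs nothing below, where the parameters can be shifted by integers.
\<close>

lemma has_integral_Beta_complex:
  assumes "Re x > 2" "Re y > 2"
  shows "((\<lambda>t. of_real t powr (x - 1) * of_real (1 - t) powr (y - 1)) has_integral Beta x y) {0..1::real}"
proof -
  define J where "J = (\<lambda>x y. integral {0..1::real} (\<lambda>t. of_real t powr (x - 1) * of_real (1 - t) powr (y - 1) :: complex))"
  have cont: "continuous_on {0..1::real} (\<lambda>t. complex_of_real (1 - t) powr (y - 1))"
       "continuous_on {0..1::real} (\<lambda>t. complex_of_real t powr (y - 1))" if "Re y > 2" for y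
    by (intro continuous_on_powr_unit; use that in \<open>auto intro!: continuous_intros\<close>)+
  have J1: "(\<lambda>x. J x y) holomorphic_on {x. Re x > 2}" if "Re y > 2" for y
    unfolding J_def by (intro holomorphic_powr_kernel_integral cont that) (auto intro: continuous_intros)
  have J2: "(\<lambda>y. J x y) holomorphic_on {y. Re y > 2}" if "Re x > 2" for x
    using holomorphic_powr_kernel_integral[of "\<lambda>t. 1 - t" "\<lambda>t. of_real t powr (x - 1)"] cont(2)[OF that]
    unfolding J_def by (simp add: mult.commute continuous_intros)
  have B1: "(\<lambda>x. Beta x y) holomorphic_on {x. Re x > 2}" if "Re y > 2" for y :: complex
    using that by (intro holomorphic_intros) (auto elim!: nonpos_Ints_cases)
  have B2: "(\<lambda>y. Beta x y) holomorphic_on {y. Re y > 2}" if "Re x > 2" for x :: complex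
    using that by (intro holomorphic_intros) (auto elim!: nonpos_Ints_cases)
  have real: "J (of_real x) (of_real y) = Beta (of_real x) (of_real y)" if "x > 2" "y > 2" for x y :: real
  proof -
    have "((\<lambda>t. t powr (x - 1) * (1 - t) powr (y - 1)) has_integral Beta x y) {0..1}"
      using that by (intro has_integral_Beta_real) auto
    then have "(((complex_of_real) \<circ> (\<lambda>t. t powr (x - 1) * (1 - t) powr (y - 1))) has_integral of_real (Beta x y)) {0..1}"
      by (rule has_integral_linear) (rule bounded_linear_of_real)
    then have "((\<lambda>t. of_real t powr (of_real x - 1) * of_real (1 - t) powr (of_real y - 1)) has_integral complex_of_real (Beta x y)) {0..1}"
    proof (rule has_integral_eq[rotated])
      fix t :: real assume t: "t \<in> {0..1}"
      show "(complex_of_real \<circ> (\<lambda>t. t powr (x - 1) * (1 - t) powr (y - 1))) t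
          = of_real t powr (of_real x - 1) * of_real (1 - t) powr (of_real y - 1)"
        using powr_of_real[of t "x - 1"] powr_of_real[of "1 - t" "y - 1"] t by simp
    qed
    then show ?thesis unfolding J_def Beta_complex_of_real by (rule integral_unique)
  qed
  have "J z (of_real y) = Beta z (of_real y)" if "Re z > 2" "y > 2" for z y
    using eq_on_halfplane[of "\<lambda>x. J x (of_real y)" "\<lambda>x. Beta x (of_real y)" z] J1 B1 real that by simp
  then have "J x y = Beta x y"
    using eq_on_halfplane[of "J x" "Beta x" y] J2[of x] B2[of x] assms by simp
  then show ?thesis
    using integral_powr_unit_has_integral[of x y] assms unfolding J_def by simp
qed

lemma Beta_plus_of_nat_left:
  fixes b c :: complex
  assumes "b \<notin> \<int>\<^sub>\<le>\<^sub>0"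
  shows "pochhammer c n * Beta (b + of_nat n) (c - b) = pochhammer b n * Beta b (c - b)"
proof (induction n)
  case (Suc n)
  have "(c + of_nat n) * Beta (b + of_nat n + 1) (c - b) = (b + of_nat n) * Beta (b + of_nat n) (c - b)"
    using Beta_plus1_left[of "b + of_nat n" "c - b"] add_of_nat_notin_nonpos_Ints[OF assms, of n]
    by (simp add: add_ac)
  then have "pochhammer c (Suc n) * Beta (b + of_nat (Suc n)) (c - b)
      = (b + of_nat n) * (pochhammer c n * Beta (b + of_nat n) (c - b))"
    by (simp add: pochhammer_Suc add_ac mult_ac)
  then show ?case unfolding Suc.IH by (simp add: pochhammer_Suc mult_ac)
qed simp



section \<open>Analytic continuation to the slit plane\<close>

abbreviation slit_plane :: "complex set" where
  "slit_plane \<equiv> UNIV - complex_of_real ` {1..}"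

lemma in_slit_plane_iff: "z \<in> slit_plane \<longleftrightarrow> Im z \<noteq> 0 \<or> Re z < 1"
proof -
  have "z \<in> complex_of_real ` {1..} \<longleftrightarrow> Im z = 0 \<and> Re z \<ge> 1"
    by (auto simp: complex_eq_iff image_iff intro!: bexI[of _ "Re z"])
  then show ?thesis by auto
qed

lemma open_slit_plane: "open slit_plane"
proof -
  have "slit_plane = {z. Im z < 0} \<union> {z. Im z > 0} \<union> {z. Re z < 1}"
    using in_slit_plane_iff by force
  then show ?thesis
    by (simp only: open_Un open_halfspace_Im_lt open_halfspace_Im_gt open_halfspace_Re_lt)
qed

lemma one_minus_mult_notin_nonpos_Reals:
  assumes "z \<in> slit_plane" "t \<in> {0..1}"
  shows "1 - z * complex_of_real t \<notin> \<real>\<^sub>\<le>\<^sub>0"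
proof
  assume "1 - z * complex_of_real t \<in> \<real>\<^sub>\<le>\<^sub>0"
  then have *: "Im z * t = 0" "Re z * t \<ge> 1"
    by (auto simp: complex_nonpos_Reals_iff)
  then have "t \<noteq> 0" by auto
  then have "Im z = 0" using * by simp
  then have "Re z < 1" using assms(1) in_slit_plane_iff by blast
  have "Re z * t \<le> max 0 (Re z)"
    using assms(2) by (cases "Re z \<ge> 0") (auto simp: mult_left_le mult_nonpos_nonneg max_def)
  with * \<open>Re z < 1\<close> show False by (auto simp: max_def split: if_splits)
qed

lemma connected_slit_plane: "connected slit_plane"
proof (rule starlike_imp_connected)
  have "closed_segment 0 z \<subseteq> slit_plane" if z: "z \<in> slit_plane" for z
  proof
    fix w assume "w \<in> closed_segment 0 z"
    then obtain t where t: "t \<in> {0..1}" "w = of_real t * z"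
      by (auto simp: closed_segment_def scaleR_conv_of_real)
    have "1 - w \<notin> \<real>\<^sub>\<le>\<^sub>0"
      using one_minus_mult_notin_nonpos_Reals[OF z t(1)] t(2) by (simp add: mult.commute)
    then show "w \<in> slit_plane"
      unfolding in_slit_plane_iff by (auto simp: complex_nonpos_Reals_iff)
  qed
  moreover have "0 \<in> slit_plane" by (simp only: in_slit_plane_iff) simp
  ultimately show "starlike slit_plane" unfolding starlike_def by blast
qed

lemma ball_subset_slit_plane: "norm z < 1 \<Longrightarrow> z \<in> slit_plane"
  using complex_Re_le_cmod[of z] unfolding in_slit_plane_iff by linarith

text \<open>
  For z in the slit plane and t in [0, 1] the number 1 - z t avoids the branch cut of the
  power function, so the integrand is holomorphic in z. The Leibniz rule needs a convex domain,
  hence it is applied on small balls.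
\<close>

lemma holomorphic_euler_integral:
  fixes w :: "real \<Rightarrow> complex"
  assumes w: "continuous_on {0..1} w"
  shows "(\<lambda>z. integral {0..1} (\<lambda>t. w t * (1 - z * of_real t) powr (-a))) holomorphic_on slit_plane"
proof -
  let ?I = "\<lambda>z. integral {0..1} (\<lambda>t. w t * (1 - z * of_real t) powr (-a))"
  have "?I field_differentiable (at z0)" if z0: "z0 \<in> slit_plane" for z0
  proof -
    obtain e where e: "e > 0" "ball z0 e \<subseteq> slit_plane"
      using openE[OF open_slit_plane z0] by metis
    let ?U = "ball z0 e"
    let ?fx = "\<lambda>z t. w t * (a * of_real t * (1 - z * of_real t) powr (-a - 1))"
    have nz: "1 - z * of_real t \<notin> \<real>\<^sub>\<le>\<^sub>0" if "z \<in> ?U" "t \<in> {0..1}" for z and t :: real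
      using one_minus_mult_notin_nonpos_Reals[of z t] that e by blast
    have 1: "((\<lambda>z. w t * (1 - z * of_real t) powr (-a)) has_field_derivative ?fx z t) (at z within ?U)"
      if "z \<in> ?U" "t \<in> cbox 0 1" for z and t :: real
    proof -
      have t: "t \<in> {0..1}" using that by simp
      have "((\<lambda>z. (1 - z * of_real t) powr (-a)) has_field_derivative a * of_real t * (1 - z * of_real t) powr (-a - 1)) (at z within ?U)"
        using nz[OF that(1) t] by (auto intro!: derivative_eq_intros)
      from DERIV_cmult[OF this, of "w t"] show ?thesis .
    qed
    have powc: "continuous_on A (\<lambda>p. (1 - f p * of_real (g p)) powr s)"
      if "continuous_on A f" "continuous_on A g" "\<And>p. p \<in> A \<Longrightarrow> f p \<in> ?U \<and> g p \<in> {0..1}"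
      for A :: "'x::topological_space set" and f g s
    proof (rule continuous_on_powr_complex)
      show "continuous_on A (\<lambda>p. 1 - f p * of_real (g p))"
        by (intro continuous_on_diff continuous_on_mult continuous_on_of_real continuous_on_const that)
      have n: "1 - f p * of_real (g p) \<notin> \<real>\<^sub>\<le>\<^sub>0" if "p \<in> A" for p
        using nz that \<open>\<And>p. p \<in> A \<Longrightarrow> f p \<in> ?U \<and> g p \<in> {0..1}\<close> by blast
      show "A \<subseteq> {p. Re (1 - f p * of_real (g p)) \<ge> 0 \<or> Im (1 - f p * of_real (g p)) \<noteq> 0}"
        using n unfolding complex_nonpos_Reals_iff by force
      show "\<And>p. p \<in> A \<Longrightarrow> 1 - f p * of_real (g p) = 0 \<Longrightarrow> 0 < Re s"
        using n by (metis nonpos_Reals_zero_I)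
    qed (rule continuous_on_const)
    have 2: "(\<lambda>t. w t * (1 - z * of_real t) powr (-a)) integrable_on cbox 0 1" if "z \<in> ?U" for z
    proof -
      have "continuous_on {0..1} (\<lambda>t::real. (1 - z * of_real t) powr (-a))"
        by (rule powc[OF continuous_on_const continuous_on_id]) (use that in auto)
      from integrable_continuous_real[OF continuous_on_mult[OF w this]] show ?thesis by simp
    qed
    have snd: "continuous_on (?U \<times> {0..1}) (snd :: complex \<times> real \<Rightarrow> real)"
        "snd ` (?U \<times> {0..1::real}) \<subseteq> {0..1}"
      by (auto intro: continuous_intros)
    have "continuous_on (?U \<times> {0..1::real}) (\<lambda>p. (1 - fst p * of_real (snd p)) powr (-a - 1))"
      by (rule powc[OF continuous_on_fst[OF continuous_on_id] snd(1)]) auto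
    then have "continuous_on (?U \<times> {0..1::real}) (\<lambda>p. ?fx (fst p) (snd p))"
      by (intro continuous_on_mult continuous_on_compose2[OF w snd] continuous_on_const continuous_on_of_real snd(1))
    then have "continuous_on (?U \<times> cbox 0 1) (\<lambda>(z, t). ?fx z t)"
      by (simp add: case_prod_unfold)
    from leibniz_rule_holomorphic[OF 1 2 this] have "?I holomorphic_on ?U" by simp
    then show ?thesis by (rule holomorphic_on_imp_differentiable_at) (use e(1) in auto)
  qed
  then show ?thesis
    by (simp add: holomorphic_on_def field_differentiable_at_within)
qed

text \<open>
  Expand (1 - z t)^{-a} by the binomial series, which converges uniformly in t for a fixed
  z in the unit disc, and integrate term by term; the n-th moment of the weight is the
  Beta value Beta b (c - b) times (b)_n / (c)_n.
\<close>

lemma euler_integral_eq_eval_fps: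
  assumes b: "Re b > 2" and cb: "Re (c - b) > 2" and z: "norm z < 1"
  defines "w \<equiv> (\<lambda>t::real. of_real t powr (b - 1) * complex_of_real (1 - t) powr (c - b - 1))"
  shows "integral {0..1} (\<lambda>t. w t * (1 - z * of_real t) powr (-a)) = Beta b (c - b) * eval_fps (gauss_fps a b c) z"
proof -
  have c: "c \<notin> \<int>\<^sub>\<le>\<^sub>0" and bn: "b \<notin> \<int>\<^sub>\<le>\<^sub>0" using b cb by (auto intro!: notin_nonpos_Ints_if_Re_pos)
  define p where "p = (\<lambda>n. pochhammer a n / fact n)"
  have w1: "norm (w t) \<le> 1" if "t \<in> {0..1}" for t
  proof -
    have "norm (w t) = t powr (Re b - 1) * (1 - t) powr (Re (c - b) - 1)"
      unfolding w_def norm_mult using that by (simp add: norm_powr_real_powr)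
    also have "\<dots> \<le> 1 * 1"
      using that b cb by (intro mult_mono powr_le1) auto
    finally show ?thesis by simp
  qed
  have psum: "summable (\<lambda>n. norm (p n * z ^ n))"
  proof -
    have "summable (\<lambda>n. norm (hypergeo_coeff a 1 1 n * z ^ n))"
      by (rule gauss_fps_summable[OF one_notin_nonpos_Ints z])
    then show ?thesis by (simp add: hypergeo_coeff_def p_def pochhammer_fact[symmetric])
  qed
  have mom: "((\<lambda>t. w t * (p n * (z * of_real t) ^ n)) has_integral
      (Beta b (c - b) * (hypergeo_coeff a b c n * z ^ n))) {0..1}" for n
  proof -
    have "((\<lambda>t. of_real t powr (b + of_nat n - 1) * of_real (1 - t) powr (c - b - 1)) has_integral Beta (b + of_nat n) (c - b)) {0..1::real}"
      using b cb by (intro has_integral_Beta_complex) auto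
    then have "((\<lambda>t. (p n * z ^ n) * (of_real t powr (b + of_nat n - 1) * of_real (1 - t) powr (c - b - 1)))
       has_integral (p n * z ^ n) * Beta (b + of_nat n) (c - b)) {0..1::real}"
      by (rule has_integral_mult_right)
    moreover have "(p n * z ^ n) * Beta (b + of_nat n) (c - b) = Beta b (c - b) * (hypergeo_coeff a b c n * z ^ n)"
    proof -
      have "Beta (b + of_nat n) (c - b) = pochhammer b n * Beta b (c - b) / pochhammer c n"
        using Beta_plus_of_nat_left[OF bn, of c n] pochhammer_nonzero[OF c, of n]
        by (simp add: field_simps)
      then show ?thesis by (simp add: p_def hypergeo_coeff_def mult_ac)
    qed
    moreover have "(p n * z ^ n) * (of_real t powr (b + of_nat n - 1) * of_real (1 - t) powr (c - b - 1))
       = w t * (p n * (z * of_real t) ^ n)" for t :: real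
    proof (cases "t = 0")
      case False
      have "b + of_nat n - 1 = b - 1 + of_nat n" by simp
      then have "complex_of_real t powr (b + of_nat n - 1) = of_real t powr (b - 1) * of_real t ^ n"
        using False by (simp only: powr_add powr_complexpow of_real_eq_0_iff not_False_eq_True)
      then show ?thesis by (simp add: w_def power_mult_distrib mult_ac)
    qed (simp add: w_def)
    ultimately show ?thesis by (simp only:)
  qed
  have "uniform_limit {0..1} (\<lambda>N t. \<Sum>n<N. w t * (p n * (z * of_real t) ^ n)) (\<lambda>t. \<Sum>n. w t * (p n * (z * of_real t) ^ n)) sequentially"
  proof (rule Weierstrass_m_test[OF _ psum])
    fix n and t :: real assume t: "t \<in> {0..1}"
    have "norm (w t) * (norm (p n * z ^ n) * t ^ n) \<le> 1 * (norm (p n * z ^ n) * 1)"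
      using t by (intro mult_mono w1 power_le_one) auto
    then show "norm (w t * (p n * (z * of_real t) ^ n)) \<le> norm (p n * z ^ n)"
      using t by (simp add: norm_mult norm_power power_mult_distrib mult_ac)
  qed
  moreover have "(\<Sum>n. w t * (p n * (z * of_real t) ^ n)) = w t * (1 - z * of_real t) powr (-a)" if "t \<in> {0..1}" for t
  proof -
    have "norm (z * of_real t) \<le> norm z * 1"
      unfolding norm_mult by (intro mult_left_mono) (use that in auto)
    then have "norm (z * of_real t) < 1" using z by simp
    from sums_mult[OF binomial_series_pochhammer[OF this, of a], of "w t"] show ?thesis
      by (simp add: p_def sums_iff)
  qed
  ultimately have ul: "uniform_limit {0..1} (\<lambda>N t. \<Sum>n<N. w t * (p n * (z * of_real t) ^ n)) (\<lambda>t. w t * (1 - z * of_real t) powr (-a)) sequentially"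
    by (subst (asm) uniform_limit_cong'[where g = "\<lambda>N t. \<Sum>n<N. w t * (p n * (z * of_real t) ^ n)" and i = "\<lambda>t. w t * (1 - z * of_real t) powr (-a)"]) auto
  have part: "((\<lambda>t. \<Sum>n<N. w t * (p n * (z * of_real t) ^ n)) has_integral
       (\<Sum>n<N. Beta b (c - b) * (hypergeo_coeff a b c n * z ^ n))) {0..1}" for N
    by (intro has_integral_sum mom) auto
  have L: "(\<lambda>N. \<Sum>n<N. Beta b (c - b) * (hypergeo_coeff a b c n * z ^ n)) \<longlonglongrightarrow> integral {0..1} (\<lambda>t. w t * (1 - z * of_real t) powr (-a))"
  proof -
    have cont: "continuous_on {0..1} (\<lambda>t. \<Sum>n<N. w t * (p n * (z * of_real t) ^ n))" for N
      unfolding w_def using b cb by (intro continuous_intros continuous_on_powr_unit) auto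
    obtain I J where IJ: "\<And>N. ((\<lambda>t. \<Sum>n<N. w t * (p n * (z * of_real t) ^ n)) has_integral I N) {0..1}"
      "((\<lambda>t. w t * (1 - z * of_real t) powr (-a)) has_integral J) {0..1}" "I \<longlonglongrightarrow> J"
      using uniform_limit_integral[OF ul cont] by auto
    have "I = (\<lambda>N. \<Sum>n<N. Beta b (c - b) * (hypergeo_coeff a b c n * z ^ n))"
      using has_integral_unique[OF IJ(1) part] by auto
    then show ?thesis using IJ(2,3) integral_unique by blast
  qed
  have "(\<lambda>n. Beta b (c - b) * (hypergeo_coeff a b c n * z ^ n)) sums (Beta b (c - b) * eval_fps (gauss_fps a b c) z)"
    unfolding eval_fps_def gauss_fps_nth
    by (rule sums_mult[OF summable_sums[OF summable_norm_cancel[OF gauss_fps_summable[OF c z]]]])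
  from LIMSEQ_unique[OF L this[unfolded sums_def]] show ?thesis .
qed



text \<open>
  The property is closed under the ring operations and differentiation, so it
  passes from a power series to any differential expression in it with polynomial coefficients.
\<close>

definition slit_continuable :: "complex fps \<Rightarrow> bool" where
  "slit_continuable G \<longleftrightarrow> (\<exists>f. f holomorphic_on slit_plane \<and> disc_expansion f G)"

lemma slit_continuable_const: "slit_continuable (fps_const k)"
  unfolding slit_continuable_def using disc_expansion_const[of k] holomorphic_on_const by blast

lemma slit_continuable_X: "slit_continuable fps_X"
  unfolding slit_continuable_def using disc_expansion_X holomorphic_on_ident by blast

lemma slit_continuable_add:
  assumes "slit_continuable G" "slit_continuable H"
  shows "slit_continuable (G + H)"
  using assms unfolding slit_continuable_def
  by (meson disc_expansion_add holomorphic_on_add)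

lemma slit_continuable_diff:
  assumes "slit_continuable G" "slit_continuable H"
  shows "slit_continuable (G - H)"
  using assms unfolding slit_continuable_def
  by (meson disc_expansion_diff holomorphic_on_diff)

lemma slit_continuable_mult:
  assumes "slit_continuable G" "slit_continuable H"
  shows "slit_continuable (G * H)"
  using assms unfolding slit_continuable_def
  by (meson disc_expansion_mult holomorphic_on_mult)

lemma slit_continuable_deriv:
  assumes "slit_continuable G"
  shows "slit_continuable (fps_deriv G)"
  using assms unfolding slit_continuable_def
  by (meson disc_expansion_deriv holomorphic_deriv open_slit_plane)

lemma slit_continuable_gauss_euler:
  assumes "Re b > 2" "Re (c - b) > 2"
  shows "slit_continuable (gauss_fps a b c)"
proof -
  let ?w = "\<lambda>t::real. of_real t powr (b - 1) * complex_of_real (1 - t) powr (c - b - 1)"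
  let ?I = "\<lambda>z. integral {0..1} (\<lambda>t. ?w t * (1 - z * of_real t) powr (-a))"
  have notin: "c \<notin> \<int>\<^sub>\<le>\<^sub>0" "b \<notin> \<int>\<^sub>\<le>\<^sub>0" "c - b \<notin> \<int>\<^sub>\<le>\<^sub>0"
    using assms by (auto intro!: notin_nonpos_Ints_if_Re_pos)
  then have nz: "Beta b (c - b) \<noteq> 0"
    by (simp add: Beta_def Gamma_eq_zero_iff)
  have "continuous_on {0..1} ?w"
    using assms by (intro continuous_on_mult continuous_on_powr_unit continuous_intros) auto
  then have "?I holomorphic_on slit_plane" by (rule holomorphic_euler_integral)
  then have "(\<lambda>z. ?I z / Beta b (c - b)) holomorphic_on slit_plane"
    by (intro holomorphic_on_divide holomorphic_on_const) (use nz in auto)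
  moreover have "?I z / Beta b (c - b) = eval_fps (gauss_fps a b c) z" if "norm z < 1" for z
    unfolding euler_integral_eq_eval_fps[OF assms that] using nz by simp
  ultimately show ?thesis
    unfolding slit_continuable_def disc_expansion_def
    using gauss_fps_conv_radius[OF notin(1), of a b] by blast
qed

lemma fps_nth_quadratic_mult:
  fixes H :: "complex fps"
  shows "fps_nth ((fps_X - fps_X * fps_X) * H) n = fps_nth (fps_X * H) n - fps_nth (fps_X * (fps_X * H)) n"
  by (simp only: left_diff_distrib mult.assoc fps_sub_nth)

lemma fps_nth_linear_mult:
  fixes H :: "complex fps"
  shows "fps_nth ((fps_const k - fps_const l * fps_X) * H) n = k * fps_nth H n - l * fps_nth (fps_X * H) n"
  by (simp only: left_diff_distrib mult.assoc fps_sub_nth fps_mult_left_const_nth)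

text \<open>
  A first-order differential operator lowers b by one. Together with the operator that lowers c it
  carries the continuation from parameters where Euler's integral converges to all others.
\<close>

lemma gauss_fps_lower_b:
  assumes c: "c \<notin> \<int>\<^sub>\<le>\<^sub>0"
  shows "fps_const (c - b - 1) * gauss_fps a b c =
     (fps_X - fps_X * fps_X) * fps_deriv (gauss_fps a (b + 1) c)
      + (fps_const (c - b - 1) - fps_const a * fps_X) * gauss_fps a (b + 1) c"
proof (rule fps_ext)
  fix n
  let ?G = "gauss_fps a (b + 1) c"
  show "fps_nth (fps_const (c - b - 1) * gauss_fps a b c) n
      = fps_nth ((fps_X - fps_X * fps_X) * fps_deriv ?G + (fps_const (c - b - 1) - fps_const a * fps_X) * ?G) n"
  proof (cases n)
    case 0
    then show ?thesis
      unfolding fps_add_nth fps_nth_quadratic_mult fps_nth_linear_mult by simp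
  next
    case (Suc m)
    have r: "fps_nth (fps_X * (fps_X * fps_deriv ?G)) (Suc m) = of_nat m * hypergeo_coeff a (b + 1) c m"
      by (cases m) auto
    have "fps_nth ((fps_X - fps_X * fps_X) * fps_deriv ?G + (fps_const (c - b - 1) - fps_const a * fps_X) * ?G) n
        = of_nat (Suc m) * hypergeo_coeff a (b + 1) c (Suc m) - of_nat m * hypergeo_coeff a (b + 1) c m
          + (c - b - 1) * hypergeo_coeff a (b + 1) c (Suc m) - a * hypergeo_coeff a (b + 1) c m"
      unfolding fps_add_nth fps_nth_quadratic_mult fps_nth_linear_mult Suc r by simp
    also have "\<dots> = (c - b - 1) * hypergeo_coeff a b c (Suc m)"
    proof -
      let ?N = "of_nat (Suc m) :: complex" and ?C = "c + of_nat m"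
      have nz: "?C \<noteq> 0" "?N \<noteq> 0"
        using add_of_nat_notin_nonpos_Ints[OF c, of m] by (auto simp del: of_nat_Suc)
      define A where "A = hypergeo_coeff a (b + 1) c m"
      have s1: "hypergeo_coeff a (b + 1) c (Suc m) = A * (a + of_nat m) * (b + ?N) / (?C * ?N)"
        using hypergeo_coeff_Suc[OF c, of a "b + 1" m] nz
        unfolding A_def by (simp add: eq_divide_eq add_ac mult_ac)
      have s2: "hypergeo_coeff a b c (Suc m) = A * (a + of_nat m) * b / (?C * ?N)"
        unfolding A_def hypergeo_coeff_def pochhammer_rec[of b m] pochhammer_Suc[of a m] pochhammer_Suc[of c m] fact_Suc
        by (simp add: mult_ac)
      have "(c - b - 1 + ?N) * (b + ?N) - ?C * ?N = (c - b - 1) * b"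
        by (simp add: algebra_simps)
      then have e: "(A * (a + of_nat m)) * ((c - b - 1 + ?N) * (b + ?N) - ?C * ?N) / (?C * ?N) = (A * (a + of_nat m)) * ((c - b - 1) * b) / (?C * ?N)"
        by simp
      have "of_nat (Suc m) * hypergeo_coeff a (b + 1) c (Suc m) - of_nat m * A
          + (c - b - 1) * hypergeo_coeff a (b + 1) c (Suc m) - a * A
        = (c - b - 1 + ?N) * hypergeo_coeff a (b + 1) c (Suc m) - A * (a + of_nat m)"
        by (simp add: algebra_simps)
      also have "\<dots> = (A * (a + of_nat m)) * ((c - b - 1 + ?N) * (b + ?N) - ?C * ?N) / (?C * ?N)"
      proof -
        have "s * (t * u / d) - t = t * (s * u - d) / d" if "d \<noteq> 0" for s t u d :: complex
          using that by (simp add: field_simps)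
        from this[of "?C * ?N" "c - b - 1 + ?N" "A * (a + of_nat m)" "b + ?N"]
        show ?thesis unfolding s1 using nz by (simp del: of_nat_Suc)
      qed
      also have "\<dots> = (c - b - 1) * hypergeo_coeff a b c (Suc m)"
        unfolding e s2 by (simp add: mult_ac)
      finally show ?thesis unfolding A_def .
    qed
    finally show ?thesis by (simp add: Suc)
  qed
qed

lemma slit_continuable_cmult_cancel:
  assumes "slit_continuable (fps_const k * G)" "k \<noteq> 0"
  shows "slit_continuable G"
proof -
  have "G = fps_const (inverse k) * (fps_const k * G)"
    using assms(2) by (simp add: fps_eq_iff)
  then show ?thesis using slit_continuable_mult[OF slit_continuable_const assms(1)] by metis
qed

lemma slit_continuable_gauss_lower_b:
  assumes "slit_continuable (gauss_fps a (b + 1) c)" "c \<notin> \<int>\<^sub>\<le>\<^sub>0" "c - b - 1 \<noteq> 0"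
  shows "slit_continuable (gauss_fps a b c)"
proof (rule slit_continuable_cmult_cancel[OF _ assms(3)])
  show "slit_continuable (fps_const (c - b - 1) * gauss_fps a b c)"
    unfolding gauss_fps_lower_b[OF assms(2)]
    by (intro slit_continuable_add slit_continuable_mult slit_continuable_diff slit_continuable_X
          slit_continuable_const slit_continuable_deriv assms(1))
qed

text \<open>
  On coefficients the Euler operator z d/dz + c multiplies by n + c, and (c + 1)_n = (c)_n (c + n) / c.
\<close>

lemma gauss_fps_lower_c:
  assumes c: "c \<notin> \<int>\<^sub>\<le>\<^sub>0"
  shows "fps_const c * gauss_fps a b c
           = fps_X * fps_deriv (gauss_fps a b (c + 1)) + fps_const c * gauss_fps a b (c + 1)"
proof (rule fps_ext)
  fix n
  have "fps_nth (fps_X * fps_deriv (gauss_fps a b (c + 1))) n = of_nat n * hypergeo_coeff a b (c + 1) n"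
    by (cases n) auto
  then show "fps_nth (fps_const c * gauss_fps a b c) n = fps_nth (fps_X * fps_deriv (gauss_fps a b (c + 1)) + fps_const c * gauss_fps a b (c + 1)) n"
    using hypergeo_coeff_raise_c[OF c, of a b n] by (simp add: algebra_simps)
qed

lemma slit_continuable_gauss_lower_c:
  assumes "slit_continuable (gauss_fps a b (c + 1))" "c \<notin> \<int>\<^sub>\<le>\<^sub>0"
  shows "slit_continuable (gauss_fps a b c)"
proof (rule slit_continuable_cmult_cancel)
  show "slit_continuable (fps_const c * gauss_fps a b c)"
    unfolding gauss_fps_lower_c[OF assms(2)]
    by (intro slit_continuable_add slit_continuable_mult slit_continuable_X
          slit_continuable_const slit_continuable_deriv assms(1))
  show "c \<noteq> 0" using assms(2) by auto
qed

text \<open>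
  Raise b by k and then c by n until Euler's integral applies, and come back by the two
  lowering operators. The operator for b requires division by c + n - b - j - 1 with j < k, which has
  positive real part because c was raised far enough; the operator for c
  requires division by c + j, which is nonzero by hypothesis.
\<close>

theorem slit_continuable_gauss:
  assumes c: "c \<notin> \<int>\<^sub>\<le>\<^sub>0"
  shows "slit_continuable (gauss_fps a b c)"
proof -
  \<comment> \<open>The bounds 2 are those of the Beta integral; n also leaves room for the k steps in b.\<close>
  obtain k :: nat where k: "real k > 2 - Re b" using reals_Archimedean2 by blast
  obtain n :: nat where n: "real n > Re b + real k + 2 - Re c" using reals_Archimedean2 by blast
  define C where "C = c + of_nat n"
  have C: "C \<notin> \<int>\<^sub>\<le>\<^sub>0" unfolding C_def by (rule add_of_nat_notin_nonpos_Ints[OF c])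
  have "slit_continuable (gauss_fps a (b + of_nat (k - j)) C)" if "j \<le> k" for j
    using that
  proof (induction j)
    case 0
    show ?case by (rule slit_continuable_gauss_euler) (use k n in \<open>auto simp: C_def\<close>)
  next
    case (Suc j)
    have *: "b + of_nat (k - Suc j) + 1 = b + of_nat (k - j)"
      using Suc.prems by (simp add: of_nat_diff)
    have "real (k - Suc j) \<le> real k - 1" using Suc.prems by (simp add: of_nat_diff)
    then have "Re (C - (b + of_nat (k - Suc j)) - 1) > 0"
      using n by (simp add: C_def)
    then have nz: "C - (b + of_nat (k - Suc j)) - 1 \<noteq> 0" by (metis less_irrefl zero_complex.sel(1))
    show ?case
    proof (rule slit_continuable_gauss_lower_b[OF _ C nz])
      show "slit_continuable (gauss_fps a (b + of_nat (k - Suc j) + 1) C)"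
        unfolding * by (rule Suc.IH) (use Suc.prems in simp)
    qed
  qed
  from this[of k] have top: "slit_continuable (gauss_fps a b (c + of_nat n))" by (simp add: C_def)
  have "slit_continuable (gauss_fps a b (c + of_nat (n - j)))" if "j \<le> n" for j
    using that
  proof (induction j)
    case (Suc j)
    have *: "c + of_nat (n - Suc j) + 1 = c + of_nat (n - j)"
      using Suc.prems by (simp add: of_nat_diff)
    show ?case
    proof (rule slit_continuable_gauss_lower_c[OF _ add_of_nat_notin_nonpos_Ints[OF c]])
      show "slit_continuable (gauss_fps a b (c + of_nat (n - Suc j) + 1))"
        unfolding * by (rule Suc.IH) (use Suc.prems in simp)
    qed
  qed (use top in simp)
  from this[of n] show ?thesis by simp
qed

text \<open>
  The function gauss_F is defined by choice; existence of the continuation is what gives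
  its defining properties any content.
\<close>

lemma gauss_F_holomorphic: "c \<notin> \<int>\<^sub>\<le>\<^sub>0 \<Longrightarrow> gauss_F a b c holomorphic_on slit_plane"
  and gauss_F_disc_expansion: "c \<notin> \<int>\<^sub>\<le>\<^sub>0 \<Longrightarrow> disc_expansion (gauss_F a b c) (gauss_fps a b c)"
proof -
  assume c: "c \<notin> \<int>\<^sub>\<le>\<^sub>0"
  have "\<exists>f. f holomorphic_on slit_plane \<and> (\<forall>z. norm z < 1 \<longrightarrow> f z = eval_fps (gauss_fps a b c) z)"
    using slit_continuable_gauss[OF c] unfolding slit_continuable_def disc_expansion_def by blast
  from someI_ex[OF this]
  have "gauss_F a b c holomorphic_on slit_plane \<and>
      (\<forall>z. norm z < 1 \<longrightarrow> gauss_F a b c z = eval_fps (gauss_fps a b c) z)"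
    unfolding gauss_F_def fps_hypergeo_eq_gauss_fps .
  then show "gauss_F a b c holomorphic_on slit_plane" "disc_expansion (gauss_F a b c) (gauss_fps a b c)"
    using gauss_fps_conv_radius[OF c, of a b] by (simp_all add: disc_expansion_def)
qed

section \<open>The hypergeometric differential equation\<close>

lemma gauss_fps_ode:
  fixes a b c :: complex
  assumes c: "c \<notin> \<int>\<^sub>\<le>\<^sub>0"
  defines "G \<equiv> gauss_fps a b c"
  shows "(fps_X - fps_X * fps_X) * fps_deriv (fps_deriv G)
       + (fps_const c - fps_const (a + b + 1) * fps_X) * fps_deriv G - fps_const (a * b) * G = 0"
proof (rule fps_ext)
  fix n
  have r0: "fps_nth (fps_X * fps_deriv G) n = of_nat n * hypergeo_coeff a b c n"
    unfolding G_def by (cases n) auto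
  have r1: "fps_nth (fps_X * fps_deriv (fps_deriv G)) n = of_nat n * of_nat (Suc n) * hypergeo_coeff a b c (Suc n)"
    unfolding G_def by (cases n) (auto simp: algebra_simps)
  have r2: "fps_nth (fps_X * (fps_X * fps_deriv (fps_deriv G))) n = of_nat n * (of_nat n - 1) * hypergeo_coeff a b c n"
    unfolding G_def
  proof (cases n)
    case (Suc m)
    then show "fps_nth (fps_X * (fps_X * fps_deriv (fps_deriv (gauss_fps a b c)))) n = of_nat n * (of_nat n - 1) * hypergeo_coeff a b c n"
      by (cases m) (auto simp: algebra_simps)
  qed simp
  have "fps_nth ((fps_X - fps_X * fps_X) * fps_deriv (fps_deriv G)
       + (fps_const c - fps_const (a + b + 1) * fps_X) * fps_deriv G - fps_const (a * b) * G) n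
     = of_nat n * of_nat (Suc n) * hypergeo_coeff a b c (Suc n) - of_nat n * (of_nat n - 1) * hypergeo_coeff a b c n
       + c * (of_nat (Suc n) * hypergeo_coeff a b c (Suc n)) - (a + b + 1) * (of_nat n * hypergeo_coeff a b c n)
       - a * b * hypergeo_coeff a b c n"
    unfolding fps_add_nth fps_sub_nth fps_nth_quadratic_mult fps_nth_linear_mult r0 r1 r2
    by (simp add: G_def)
  also have "\<dots> = hypergeo_coeff a b c (Suc n) * (c + of_nat n) * of_nat (Suc n)
       - hypergeo_coeff a b c n * (a + of_nat n) * (b + of_nat n)"
    by (simp add: algebra_simps)
  also have "\<dots> = 0" unfolding hypergeo_coeff_Suc[OF c] by simp
  finally show "fps_nth ((fps_X - fps_X * fps_X) * fps_deriv (fps_deriv G)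
       + (fps_const c - fps_const (a + b + 1) * fps_X) * fps_deriv G - fps_const (a * b) * G) n = fps_nth 0 n"
    by simp
qed

text \<open>
  The differential equation holds in the disc by comparing coefficients, and on the connected
  slit plane by the identity theorem.
\<close>

theorem gauss_F_ode:
  fixes a b c z :: complex
  assumes c: "c \<notin> \<int>\<^sub>\<le>\<^sub>0" and z: "z \<in> slit_plane"
  defines "F \<equiv> gauss_F a b c"
  shows "z * (1 - z) * deriv (deriv F) z + (c - (a + b + 1) * z) * deriv F z - a * b * F z = 0"
proof -
  have F: "F holomorphic_on slit_plane" unfolding F_def by (rule gauss_F_holomorphic[OF c])
  have F1: "deriv F holomorphic_on slit_plane" by (rule holomorphic_deriv[OF F open_slit_plane])
  have F2: "deriv (deriv F) holomorphic_on slit_plane" by (rule holomorphic_deriv[OF F1 open_slit_plane])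
  have exp: "disc_expansion F (gauss_fps a b c)" unfolding F_def by (rule gauss_F_disc_expansion[OF c])
  define L where "L = (\<lambda>z. (z - z * z) * deriv (deriv F) z + (c - (a + b + 1) * z) * deriv F z - a * b * F z)"
  have "disc_expansion L 0"
    unfolding L_def gauss_fps_ode[OF c, of a b, symmetric] by (intro disc_expansion_intros exp)
  have "L z = 0"
  proof (rule analytic_continuation[where f = L and S = slit_plane and U = "ball 0 1" and \<xi> = 0])
    show "L holomorphic_on slit_plane"
      unfolding L_def by (intro holomorphic_intros F F1 F2)
    show "ball 0 1 \<subseteq> slit_plane" using ball_subset_slit_plane by auto
    show "(0::complex) islimpt ball 0 1" by (simp add: islimpt_ball)
    show "0 \<in> slit_plane" by (rule ball_subset_slit_plane) simp
    show "L z = 0" if "z \<in> ball 0 1" for z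
      using disc_expansionD[OF \<open>disc_expansion L 0\<close>, of z] that by simp
  qed (use z connected_slit_plane open_slit_plane in auto)
  then show ?thesis by (simp add: L_def algebra_simps)
qed



section \<open>The recurrence for the moments\<close>

text \<open>
  With a complex exponent and the open interval, the integral fits both the shift of the exponent by
  one and the improper fundamental theorem of calculus.
\<close>

definition moment :: "complex \<Rightarrow> complex \<Rightarrow> complex \<Rightarrow> complex \<Rightarrow> complex \<Rightarrow> complex" where
  "moment \<epsilon> s a b c =
     (LINT x:{0<..<1::real}|lborel. complex_of_real x powr s * gauss_F a b c (\<epsilon> * complex_of_real x))"

lemma Phi_eq_moment: "Phi m \<epsilon> lam a b c = moment \<epsilon> (of_nat m + lam) a b c"
  unfolding Phi_def moment_def
  using interval_integral_Icc[of 0 1 "\<lambda>x. complex_of_real x powr (of_nat m + lam) * gauss_F a b c (\<epsilon> * complex_of_real x)"]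
    interval_integral_Ioo[of 0 1 "\<lambda>x. complex_of_real x powr (of_nat m + lam) * gauss_F a b c (\<epsilon> * complex_of_real x)"]
  by (simp add: zero_ereal_def one_ereal_def)

lemma gauss_F_field_derivative:
  assumes "c \<notin> \<int>\<^sub>\<le>\<^sub>0" "z \<in> slit_plane"
  shows "(gauss_F a b c has_field_derivative deriv (gauss_F a b c) z) (at z)"
    and "(deriv (gauss_F a b c) has_field_derivative deriv (deriv (gauss_F a b c)) z) (at z)"
  using holomorphic_derivI[OF gauss_F_holomorphic[OF assms(1)] open_slit_plane assms(2)]
    holomorphic_derivI[OF holomorphic_deriv[OF gauss_F_holomorphic[OF assms(1)] open_slit_plane] open_slit_plane assms(2)]
  by blast+

lemma gauss_F_along_ray:
  fixes a b c \<epsilon> :: complex and x :: real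
  assumes "c \<notin> \<int>\<^sub>\<le>\<^sub>0" "\<epsilon> * of_real x \<in> slit_plane"
  shows "isCont (\<lambda>x. gauss_F a b c (\<epsilon> * of_real x)) x"
    and "isCont (\<lambda>x. deriv (gauss_F a b c) (\<epsilon> * of_real x)) x"
proof -
  have "isCont (\<lambda>x::real. \<epsilon> * of_real x) x" by (intro continuous_intros)
  then show "isCont (\<lambda>x. gauss_F a b c (\<epsilon> * of_real x)) x"
    "isCont (\<lambda>x. deriv (gauss_F a b c) (\<epsilon> * of_real x)) x"
    using gauss_F_field_derivative[OF assms, of a b, THEN DERIV_isCont]
      isCont_o2[of x "\<lambda>x. \<epsilon> * of_real x"] by blast+
qed

lemma unit_ray_in_slit_plane:
  assumes "\<epsilon> \<in> {1, -1}" "x \<in> {0<..<1}"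
  shows "\<epsilon> * complex_of_real x \<in> slit_plane"
  by (rule ball_subset_slit_plane) (use assms in \<open>auto simp: norm_mult\<close>)

text \<open>
  Integrating the hypergeometric equation against z^M by parts, twice for the second-order term
  and once for the first-order terms, leaves exactly this expression as boundary contribution. The equation therefore removes F' and F'' from its derivative.
\<close>

definition boundary_form :: "complex \<Rightarrow> complex \<Rightarrow> complex \<Rightarrow> complex \<Rightarrow> complex \<Rightarrow> complex \<Rightarrow> complex" where
  "boundary_form \<epsilon> M a b c z =
     z powr (M + 1) * ((1 - \<epsilon> * z) * (\<epsilon> * deriv (gauss_F a b c) (\<epsilon> * z)))
     + ((c - M - 1) * z powr M - \<epsilon> * (a + b - 1 - M) * z powr (M + 1)) * gauss_F a b c (\<epsilon> * z)"

text \<open>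
  Writing D for the left-hand side of the hypergeometric equation at \<epsilon> z, the derivative
  equals the asserted combination plus \<epsilon> z^M D. The sign enters only through \<epsilon>^2 = 1.
\<close>

lemma boundary_form_derivative:
  assumes c: "c \<notin> \<int>\<^sub>\<le>\<^sub>0" and \<epsilon>: "\<epsilon> \<in> {1, -1}" and z: "\<epsilon> * z \<in> slit_plane" "z \<notin> \<real>\<^sub>\<le>\<^sub>0"
  shows "(boundary_form \<epsilon> M a b c has_field_derivative
     (\<epsilon> * (M + 1 - a) * (M + 1 - b)) * (z powr M * gauss_F a b c (\<epsilon> * z))
      - (M * (M + 1 - c)) * (z powr (M - 1) * gauss_F a b c (\<epsilon> * z))) (at z)"
proof -
  define F where "F = gauss_F a b c"
  define F0 F1 F2 where "F0 = F (\<epsilon> * z)" and "F1 = deriv F (\<epsilon> * z)" and "F2 = deriv (deriv F) (\<epsilon> * z)"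
  define P where "P = z powr (M - 1)"
  have z0: "z \<noteq> 0" using z(2) by auto
  have PM: "z powr M = P * z" "z powr (M + 1) = P * z * z"
  proof -
    have "M = M - 1 + 1" "M + 1 = M - 1 + 1 + 1" by simp_all
    then show "z powr M = P * z" "z powr (M + 1) = P * z * z"
      unfolding P_def using z0 by (metis powr_add powr_to_1)+
  qed
  have lin: "((\<lambda>z. \<epsilon> * z) has_field_derivative \<epsilon>) (at z)"
    using DERIV_cmult_Id[of \<epsilon> z] by simp
  have dF: "((\<lambda>z. F (\<epsilon> * z)) has_field_derivative F1 * \<epsilon>) (at z)"
    using DERIV_chain2[OF gauss_F_field_derivative(1)[OF c z(1), of a b] lin] by (simp add: F_def F1_def)
  have dF1: "((\<lambda>z. deriv F (\<epsilon> * z)) has_field_derivative F2 * \<epsilon>) (at z)"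
    using DERIV_chain2[OF gauss_F_field_derivative(2)[OF c z(1), of a b] lin] by (simp add: F_def F2_def)
  have dp: "((\<lambda>z. z powr s) has_field_derivative s * z powr (s - 1)) (at z)" for s
    by (rule has_field_derivative_powr[OF z(2)])
  have dp1: "((\<lambda>z. z powr (M + 1)) has_field_derivative (M + 1) * (P * z)) (at z)"
    using dp[of "M + 1"] PM by simp
  have dp0: "((\<lambda>z. z powr M) has_field_derivative M * P) (at z)"
    using dp[of M] by (simp add: P_def)
  have ode: "\<epsilon> * z * (1 - \<epsilon> * z) * F2 + (c - (a + b + 1) * (\<epsilon> * z)) * F1 - a * b * F0 = 0"
    using gauss_F_ode[OF c z(1), of a b] by (simp add: F_def F0_def F1_def F2_def)
  have "(boundary_form \<epsilon> M a b c has_field_derivative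
      ((M + 1) * (P * z) * ((1 - \<epsilon> * z) * (\<epsilon> * F1))
        + ((0 - \<epsilon>) * (\<epsilon> * F1) + \<epsilon> * (F2 * \<epsilon>) * (1 - \<epsilon> * z)) * (P * z * z))
      + (((c - M - 1) * (M * P) - \<epsilon> * (a + b - 1 - M) * ((M + 1) * (P * z))) * F0
        + F1 * \<epsilon> * ((c - M - 1) * (P * z) - \<epsilon> * (a + b - 1 - M) * (P * z * z)))) (at z)"
    (is "(_ has_field_derivative ?D) _")
    unfolding boundary_form_def F_def[symmetric] F0_def F1_def[symmetric] PM[symmetric]
    using DERIV_add[OF DERIV_mult[OF dp1 DERIV_mult[OF DERIV_diff[OF DERIV_const lin] DERIV_cmult[OF dF1, of \<epsilon>]]]
       DERIV_mult[OF DERIV_diff[OF DERIV_cmult[OF dp0, of "c - M - 1"] DERIV_cmult[OF dp1, of "\<epsilon> * (a + b - 1 - M)"]] dF], of 1]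
    by (simp only: PM F1_def)
  moreover have "?D = (\<epsilon> * (M + 1 - a) * (M + 1 - b)) * (P * z * F0) - (M * (M + 1 - c)) * (P * F0)
      + \<epsilon> * (P * z) * (\<epsilon> * z * (1 - \<epsilon> * z) * F2 + (c - (a + b + 1) * (\<epsilon> * z)) * F1 - a * b * F0)"
    using \<epsilon> by (elim insertE) (simp_all add: algebra_simps)
  ultimately show ?thesis unfolding ode PM P_def[symmetric] F_def[symmetric] F0_def[symmetric] by simp
qed

lemma boundary_form_tendsto_0:
  assumes c: "c \<notin> \<int>\<^sub>\<le>\<^sub>0" and M: "Re M > 0"
  shows "((\<lambda>x::real. boundary_form \<epsilon> M a b c (of_real x)) \<longlongrightarrow> 0) (at_right 0)"
proof -
  have pow: "((\<lambda>x::real. complex_of_real x powr s) \<longlongrightarrow> 0) (at_right 0)" if "Re s > 0" for s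
  proof (rule tendsto_powr_complex_0[OF _ tendsto_const that])
    show "((\<lambda>x::real. complex_of_real x) \<longlongrightarrow> 0) (at_right 0)"
      using tendsto_of_real[OF tendsto_ident_at[of "0::real" "{0<..}"], where 'a = complex] by simp
  qed
  have slit: "\<epsilon> * complex_of_real 0 \<in> slit_plane" by (rule ball_subset_slit_plane) simp
  have lim: "((\<lambda>x. gauss_F a b c (\<epsilon> * of_real x)) \<longlongrightarrow> gauss_F a b c (\<epsilon> * of_real 0)) (at_right 0)"
    "((\<lambda>x. deriv (gauss_F a b c) (\<epsilon> * of_real x)) \<longlongrightarrow> deriv (gauss_F a b c) (\<epsilon> * of_real 0)) (at_right 0)"
    by (rule tendsto_within_subset[OF _ subset_UNIV],
        rule gauss_F_along_ray[OF c slit, of a b, unfolded isCont_def])+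
  have "((\<lambda>x. boundary_form \<epsilon> M a b c (of_real x)) \<longlongrightarrow>
     0 * ((1 - \<epsilon> * of_real 0) * (\<epsilon> * deriv (gauss_F a b c) (\<epsilon> * of_real 0)))
     + ((c - M - 1) * 0 - \<epsilon> * (a + b - 1 - M) * 0) * gauss_F a b c (\<epsilon> * of_real 0)) (at_right (0::real))"
    unfolding boundary_form_def
    by (intro tendsto_add tendsto_mult tendsto_diff tendsto_const pow lim tendsto_of_real tendsto_ident_at)
       (use M in auto)
  then show ?thesis by simp
qed

text \<open>
  The fundamental theorem of calculus on (0, 1) applied to the boundary form, which vanishes at 0
  because Re M > 0.
\<close>

theorem moment_recurrence:
  assumes c: "c \<notin> \<int>\<^sub>\<le>\<^sub>0" and \<epsilon>: "\<epsilon> \<in> {1, -1}" and M: "Re M > 0"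
    and int: "\<And>s. Re s > -1 \<Longrightarrow>
        set_integrable lborel {0<..<1} (\<lambda>x. complex_of_real x powr s * gauss_F a b c (\<epsilon> * of_real x))"
    and L: "((\<lambda>x::real. boundary_form \<epsilon> M a b c (of_real x)) \<longlongrightarrow> L) (at_left 1)"
  shows "\<epsilon> * (M + 1 - a) * (M + 1 - b) * moment \<epsilon> M a b c = M * (M + 1 - c) * moment \<epsilon> (M - 1) a b c + L"
proof -
  let ?f = "\<lambda>s x. complex_of_real x powr s * gauss_F a b c (\<epsilon> * of_real x)"
  let ?A = "\<epsilon> * (M + 1 - a) * (M + 1 - b)" and ?B = "M * (M + 1 - c)"
  define g where "g = (\<lambda>x. ?A * ?f M x - ?B * ?f (M - 1) x)"
  have i1: "set_integrable lborel {0<..<1} (?f M)" and i2: "set_integrable lborel {0<..<1} (?f (M - 1))"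
    by (rule int; use M in simp)+
  have j: "set_integrable lborel {0<..<1} (\<lambda>x. ?A * ?f M x)" "set_integrable lborel {0<..<1} (\<lambda>x. ?B * ?f (M - 1) x)"
    by (intro set_integrable_mult_right i1 i2)+
  have "(LBINT x=ereal 0..ereal 1. g x) = L - 0"
  proof (rule interval_integral_FTC_integrable[where F = "\<lambda>x. boundary_form \<epsilon> M a b c (of_real x)"])
    fix x :: real assume "ereal 0 < ereal x" "ereal x < ereal 1"
    then have x: "x \<in> {0<..<1}" by simp
    have slit: "\<epsilon> * of_real x \<in> slit_plane" by (rule unit_ray_in_slit_plane[OF \<epsilon> x])
    have pos: "complex_of_real x \<notin> \<real>\<^sub>\<le>\<^sub>0" using x by auto
    show "((\<lambda>x. boundary_form \<epsilon> M a b c (of_real x)) has_vector_derivative g x) (at x)"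
      unfolding g_def by (rule has_vector_derivative_real_field[OF boundary_form_derivative[OF c \<epsilon> slit pos]])
    have pow: "isCont (\<lambda>x::real. complex_of_real x powr s) x" for s
      using pos by (intro continuous_intros) auto
    show "isCont g x"
      unfolding g_def
      by (intro continuous_const isCont_diff isCont_mult pow gauss_F_along_ray(1)[OF c slit])
  next
    show "set_integrable lborel (einterval (ereal 0) (ereal 1)) g"
      unfolding g_def einterval_eq by (intro set_integral_diff j)
    show "(((\<lambda>x. boundary_form \<epsilon> M a b c (of_real x)) \<circ> real_of_ereal) \<longlongrightarrow> 0) (at_right (ereal 0))"
      unfolding ereal_tendsto_simps by (rule boundary_form_tendsto_0[OF c M])
    show "(((\<lambda>x. boundary_form \<epsilon> M a b c (of_real x)) \<circ> real_of_ereal) \<longlongrightarrow> L) (at_left (ereal 1))"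
      unfolding ereal_tendsto_simps by (rule L)
  qed simp
  moreover have "(LBINT x=ereal 0..ereal 1. g x) = ?A * moment \<epsilon> M a b c - ?B * moment \<epsilon> (M - 1) a b c"
    unfolding g_def moment_def
    by (simp only: interval_lebesgue_integral_le_eq ereal_less_eq zero_le_one einterval_eq
          set_integral_diff(2)[OF j] set_integral_mult_right)
  ultimately show ?thesis by (simp add: algebra_simps)
qed

text \<open>
  The integrand is dominated by a Beta integrand with exponents Re s > -1 and -\<sigma> > -1.
\<close>

lemma gauss_moment_integrable:
  assumes c: "c \<notin> \<int>\<^sub>\<le>\<^sub>0" and \<epsilon>: "\<epsilon> \<in> {1, -1}" and \<sigma>: "\<sigma> < 1"
    and bound: "\<And>x. x \<in> {0<..<1} \<Longrightarrow> norm (gauss_F a b c (\<epsilon> * of_real x)) \<le> K * (1 - x) powr (-\<sigma>)"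
    and s: "Re s > -1"
  shows "set_integrable lborel {0<..<1} (\<lambda>x. complex_of_real x powr s * gauss_F a b c (\<epsilon> * of_real x))"
proof (rule set_integrable_bound)
  have "set_integrable lborel {0..1} (\<lambda>t. t powr ((Re s + 1) - 1) * (1 - t) powr ((1 - \<sigma>) - 1))"
    by (rule integrable_Beta) (use s \<sigma> in auto)
  then have "set_integrable lborel {0<..<1} (\<lambda>t. t powr ((Re s + 1) - 1) * (1 - t) powr ((1 - \<sigma>) - 1))"
    by (rule set_integrable_subset) auto
  then show "set_integrable lborel {0<..<1} (\<lambda>x. K * (x powr Re s * (1 - x) powr (-\<sigma>)))"
    by (intro set_integrable_mult_right) simp
  have "isCont (\<lambda>x. complex_of_real x powr s * gauss_F a b c (\<epsilon> * of_real x)) x" if x: "x \<in> {0<..<1}" for x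
  proof -
    have "complex_of_real x \<notin> \<real>\<^sub>\<le>\<^sub>0" using x by auto
    then show ?thesis
      by (intro continuous_intros gauss_F_along_ray(1)[OF c unit_ray_in_slit_plane[OF \<epsilon> x]]) auto
  qed
  then have "continuous_on {0<..<1} (\<lambda>x. complex_of_real x powr s * gauss_F a b c (\<epsilon> * of_real x))"
    by (intro continuous_at_imp_continuous_on) blast
  then have "(\<lambda>x. indicator {0<..<1} x *\<^sub>R (complex_of_real x powr s * gauss_F a b c (\<epsilon> * of_real x)))
      \<in> borel_measurable borel"
    by (intro borel_measurable_continuous_on_indicator) auto
  then show "set_borel_measurable lborel {0<..<1} (\<lambda>x. complex_of_real x powr s * gauss_F a b c (\<epsilon> * of_real x))"
    unfolding set_borel_measurable_def by simp
  show "AE x in lborel. x \<in> {0<..<1} \<longrightarrow> norm (complex_of_real x powr s * gauss_F a b c (\<epsilon> * of_real x))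
          \<le> norm (K * (x powr Re s * (1 - x) powr (-\<sigma>)))"
  proof (rule AE_I2, rule impI)
    fix x :: real assume x: "x \<in> {0<..<1}"
    have "norm (complex_of_real x powr s * gauss_F a b c (\<epsilon> * of_real x)) = x powr Re s * norm (gauss_F a b c (\<epsilon> * of_real x))"
      using x by (simp add: norm_mult norm_powr_real_powr)
    also have "\<dots> \<le> x powr Re s * (K * (1 - x) powr (-\<sigma>))"
      by (intro mult_left_mono bound x) simp
    also have "\<dots> \<le> norm (K * (x powr Re s * (1 - x) powr (-\<sigma>)))"
      by (simp add: mult_ac)
    finally show "norm (complex_of_real x powr s * gauss_F a b c (\<epsilon> * of_real x)) \<le> norm (K * (x powr Re s * (1 - x) powr (-\<sigma>)))" .
  qed
qed

lemma gauss_F_bound_at_1: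
  assumes c: "c \<notin> \<int>\<^sub>\<le>\<^sub>0" and re: "Re (c - a - b) > -1"
  obtains \<sigma> K where "\<sigma> < 1"
    "\<And>x. x \<in> {0<..<1} \<Longrightarrow> norm (gauss_F a b c (of_real x)) \<le> K * (1 - x) powr (-\<sigma>)"
proof -
  \<comment> \<open>This is where the hypothesis Re (c - a - b) > -1 makes the singularity at 1 integrable.\<close>
  obtain \<sigma> where \<sigma>: "max 0 (Re (a + b - c)) < \<sigma>" "\<sigma> < 1"
    using dense[of "max 0 (Re (a + b - c))" 1] re by auto
  have "\<sigma> > 0" "Re (a + b - c) \<le> \<sigma>" using \<sigma>(1) by auto
  from gauss_fps_norm_bound[OF c this] obtain K where
    K: "\<And>z. norm z < 1 \<Longrightarrow> norm (eval_fps (gauss_fps a b c) z) \<le> K * (1 - norm z) powr (-\<sigma>)"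
    by metis
  have "norm (gauss_F a b c (of_real x)) \<le> K * (1 - x) powr (-\<sigma>)" if "x \<in> {0<..<1}" for x
    using K[of "of_real x"] disc_expansionD[OF gauss_F_disc_expansion[OF c], of "of_real x"] that by simp
  with \<sigma>(2) show ?thesis by (rule that)
qed

lemma gauss_F_bound_at_minus_1:
  assumes c: "c \<notin> \<int>\<^sub>\<le>\<^sub>0"
  obtains K where "\<And>x. x \<in> {0<..<1} \<Longrightarrow> norm (gauss_F a b c (- of_real x)) \<le> K * (1 - x) powr (- 0)"
proof -
  have slit: "-1 * complex_of_real x \<in> slit_plane" if "x \<in> {0..1}" for x
    using that unfolding in_slit_plane_iff by simp
  have "continuous_on {0..1} (\<lambda>x::real. gauss_F a b c (-1 * of_real x))"
    by (rule continuous_at_imp_continuous_on) (use gauss_F_along_ray(1)[OF c slit] in blast)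
  then have "compact ((\<lambda>x::real. gauss_F a b c (-1 * of_real x)) ` {0..1})"
    by (rule compact_continuous_image) simp
  then have "bounded ((\<lambda>x::real. gauss_F a b c (-1 * of_real x)) ` {0..1})"
    by (rule compact_imp_bounded)
  then obtain K where K: "\<forall>x\<in>{0..1}. norm (gauss_F a b c (-1 * complex_of_real x)) \<le> K"
    unfolding bounded_iff by blast
  show ?thesis
  proof (rule that[of K])
    show "norm (gauss_F a b c (- of_real x)) \<le> K * (1 - x) powr (- 0)" if "x \<in> {0<..<1}" for x
      using K that by simp
  qed
qed

text \<open>
  The terms are regrouped as x^{M+1} ((1 - x) F' + (c - a - b) F) + (c - M - 1) x^M (1 - x) F.
  The first group tends to E_plus, and the second vanishes because F grows more slowly
  than 1 / (1 - x).
\<close>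

lemma boundary_form_limit_plus:
  assumes c: "c \<notin> \<int>\<^sub>\<le>\<^sub>0" and re: "Re (c - a - b) > -1"
  shows "((\<lambda>x::real. boundary_form 1 M a b c (of_real x)) \<longlongrightarrow> E_plus a b c) (at_left 1)"
proof -
  let ?F = "gauss_F a b c"
  have ev: "eventually (\<lambda>x::real. x \<in> {0<..<1}) (at_left 1)"
    by (rule eventually_at_leftI[of 0]) auto
  obtain \<sigma> K where \<sigma>: "\<sigma> < 1" and K: "\<And>x. x \<in> {0<..<1} \<Longrightarrow> norm (?F (of_real x)) \<le> K * (1 - x) powr (-\<sigma>)"
    by (rule gauss_F_bound_at_1[OF c re]) blast
  have small: "((\<lambda>x::real. (1 - of_real x) * ?F (of_real x)) \<longlongrightarrow> 0) (at_left 1)"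
  proof (rule Lim_null_comparison)
    show "eventually (\<lambda>x::real. norm ((1 - of_real x) * ?F (of_real x)) \<le> K * (1 - x) powr (1 - \<sigma>)) (at_left 1)"
      using ev
    proof eventually_elim
      case (elim x)
      have "norm (1 - complex_of_real x) = 1 - x"
        using elim by (metis abs_of_pos diff_gt_0_iff_gt greaterThanLessThan_iff norm_of_real of_real_1 of_real_diff)
      then have "norm ((1 - of_real x) * ?F (of_real x)) \<le> (1 - x) * (K * (1 - x) powr (-\<sigma>))"
        unfolding norm_mult using K[OF elim] elim by (simp add: mult_left_mono)
      also have "\<dots> = K * (1 - x) powr (1 - \<sigma>)"
        using elim powr_add[of "1 - x" 1 "-\<sigma>"] by simp
      finally show ?case .
    qed
    have "((\<lambda>x::real. 1 - x) \<longlongrightarrow> 1 - 1) (at_left 1)"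
      by (intro tendsto_intros)
    then have "((\<lambda>x::real. 1 - x) \<longlongrightarrow> 0) (at_left 1)" by simp
    then have "((\<lambda>x::real. (1 - x) powr (1 - \<sigma>)) \<longlongrightarrow> 0) (at_left 1)"
      by (rule tendsto_zero_powrI[OF _ tendsto_const]) (use \<sigma> ev in \<open>auto elim!: eventually_mono\<close>)
    then show "((\<lambda>x::real. K * (1 - x) powr (1 - \<sigma>)) \<longlongrightarrow> 0) (at_left 1)"
      by (rule tendsto_mult_right_zero)
  qed
  have pow: "((\<lambda>x::real. complex_of_real x powr s) \<longlongrightarrow> 1) (at_left 1)" for s
  proof -
    have "isCont (\<lambda>x::real. complex_of_real x powr s) 1"
      by (intro continuous_intros) auto
    then show ?thesis unfolding isCont_def by (auto intro: tendsto_within_subset[OF _ subset_UNIV])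
  qed
  have lim: "((\<lambda>x::real. of_real x powr (M + 1) * ((1 - of_real x) * deriv ?F (of_real x) + (c - a - b) * ?F (of_real x))
        + (c - M - 1) * of_real x powr M * ((1 - of_real x) * ?F (of_real x)))
        \<longlongrightarrow> 1 * E_plus a b c + (c - M - 1) * 1 * 0) (at_left 1)"
    by (intro tendsto_add tendsto_mult tendsto_const pow small E_plus_limit[OF c re gauss_F_disc_expansion[OF c]])
  have "eventually (\<lambda>x::real. of_real x powr (M + 1) * ((1 - of_real x) * deriv ?F (of_real x) + (c - a - b) * ?F (of_real x))
        + (c - M - 1) * of_real x powr M * ((1 - of_real x) * ?F (of_real x)) = boundary_form 1 M a b c (of_real x)) (at_left 1)"
    using ev
  proof eventually_elim
    case (elim x)
    then have "complex_of_real x powr (M + 1) = of_real x powr M * of_real x"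
      by (simp add: powr_add)
    then show ?case unfolding boundary_form_def by (simp add: algebra_simps)
  qed
  from Lim_transform_eventually[OF lim this] show ?thesis by simp
qed

lemma boundary_form_limit_minus:
  assumes c: "c \<notin> \<int>\<^sub>\<le>\<^sub>0"
  shows "((\<lambda>x::real. boundary_form (-1) M a b c (of_real x)) \<longlongrightarrow> E_minus M a b c) (at_left 1)"
proof -
  have slit: "-1 * complex_of_real 1 \<in> slit_plane" unfolding in_slit_plane_iff by simp
  have pow: "isCont (\<lambda>x::real. complex_of_real x powr s) 1" for s
    by (intro continuous_intros) auto
  have id: "isCont (\<lambda>x::real. complex_of_real x) 1"
    by (intro continuous_intros)
  have "isCont (\<lambda>x::real. boundary_form (-1) M a b c (of_real x)) 1"
    unfolding boundary_form_def
    by (intro continuous_const isCont_add isCont_diff isCont_mult pow id gauss_F_along_ray[OF c slit])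
  then have "((\<lambda>x::real. boundary_form (-1) M a b c (of_real x)) \<longlongrightarrow> boundary_form (-1) M a b c (of_real 1)) (at_left 1)"
    unfolding isCont_def by (rule tendsto_within_subset) simp
  also have "boundary_form (-1) M a b c (of_real 1) = E_minus M a b c"
    by (simp add: boundary_form_def E_minus_def algebra_simps)
  finally show ?thesis .
qed

text \<open>
  The two signs differ only in how the limit at 1 and the integrability there are obtained.
\<close>

theorem moment_recurrence_E_term:
  assumes c: "c \<notin> \<int>\<^sub>\<le>\<^sub>0" and \<epsilon>: "\<epsilon> \<in> {1, -1}" and re: "\<epsilon> = 1 \<Longrightarrow> Re (c - a - b) > -1" and M: "Re M > 0"
  shows "\<epsilon> * (M + 1 - a) * (M + 1 - b) * moment \<epsilon> M a b c
           = M * (M + 1 - c) * moment \<epsilon> (M - 1) a b c + E_term \<epsilon> M a b c"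
proof (rule moment_recurrence[OF c \<epsilon> M])
  consider "\<epsilon> = 1" | "\<epsilon> = -1" using \<epsilon> by blast
  then show "((\<lambda>x::real. boundary_form \<epsilon> M a b c (of_real x)) \<longlongrightarrow> E_term \<epsilon> M a b c) (at_left 1)"
    by cases (use boundary_form_limit_plus[OF c re] boundary_form_limit_minus[OF c] in \<open>auto simp: E_term_def\<close>)
  show "set_integrable lborel {0<..<1} (\<lambda>x. complex_of_real x powr s * gauss_F a b c (\<epsilon> * of_real x))"
    if s: "Re s > -1" for s
  proof (cases "\<epsilon> = 1")
    case True
    obtain \<sigma> K where "\<sigma> < 1" "\<And>x. x \<in> {0<..<1} \<Longrightarrow> norm (gauss_F a b c (of_real x)) \<le> K * (1 - x) powr (-\<sigma>)"
      by (rule gauss_F_bound_at_1[OF c re[OF True]]) blast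
    then show ?thesis
      by (intro gauss_moment_integrable[OF c \<epsilon> _ _ s]) (auto simp: True)
  next
    case False
    then have m1: "\<epsilon> = -1" using \<epsilon> by simp
    obtain K where "\<And>x. x \<in> {0<..<1} \<Longrightarrow> norm (gauss_F a b c (- of_real x)) \<le> K * (1 - x) powr (- 0)"
      by (rule gauss_F_bound_at_minus_1[OF c]) blast
    then show ?thesis
      by (intro gauss_moment_integrable[OF c \<epsilon> zero_less_one _ s]) (simp add: m1)
  qed
qed

section \<open>The closed formula for the moments\<close>

theorem theorem2p3:
  fixes a b c lam \<epsilon> :: complex and m :: nat
  assumes "c \<notin> \<int>\<^sub>\<le>\<^sub>0"
    and "Re lam > -1"
    and "\<epsilon> \<in> {1, -1}"
    and "\<epsilon> = 1 \<Longrightarrow> Re (c - a - b) > -1"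
    and "\<And>j. j \<in> {1..m} \<Longrightarrow>
           (of_nat j + lam + 1 - a) * (of_nat j + lam + 1 - b) \<noteq> 0"
  shows "Phi m \<epsilon> lam a b c =
           (\<Prod>l=1..m. rho l lam a b c \<epsilon>) * Phi 0 \<epsilon> lam a b c +
           (\<Sum>j=1..m. E_term \<epsilon> (of_nat j + lam) a b c /
                      (\<epsilon> * (of_nat j + lam + 1 - a) * (of_nat j + lam + 1 - b)) *
                      (\<Prod>l=j+1..m. rho l lam a b c \<epsilon>))"
  using assms(5)
proof (induction m)
  case (Suc m)
  let ?r = "\<lambda>l. rho l lam a b c \<epsilon>"
  let ?e = "\<lambda>j. E_term \<epsilon> (of_nat j + lam) a b c / (\<epsilon> * (of_nat j + lam + 1 - a) * (of_nat j + lam + 1 - b))"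
  define M where "M = of_nat (Suc m) + lam"
  define D where "D = \<epsilon> * (M + 1 - a) * (M + 1 - b)"
  have D: "D \<noteq> 0"
    using Suc.prems[of "Suc m"] assms(3) unfolding D_def M_def by auto
  have M: "Re M > 0" using assms(2) unfolding M_def by simp
  have "D * Phi (Suc m) \<epsilon> lam a b c = M * (M + 1 - c) * Phi m \<epsilon> lam a b c + E_term \<epsilon> M a b c"
    using moment_recurrence_E_term[OF assms(1,3,4) M]
    unfolding D_def Phi_eq_moment by (simp add: M_def)
  then have "Phi (Suc m) \<epsilon> lam a b c = (M * (M + 1 - c) / D) * Phi m \<epsilon> lam a b c + E_term \<epsilon> M a b c / D"
    using D by (simp add: field_simps)
  then have step: "Phi (Suc m) \<epsilon> lam a b c = ?r (Suc m) * Phi m \<epsilon> lam a b c + ?e (Suc m)"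
    unfolding rho_def D_def M_def .
  have IH: "Phi m \<epsilon> lam a b c = (\<Prod>l=1..m. ?r l) * Phi 0 \<epsilon> lam a b c + (\<Sum>j=1..m. ?e j * (\<Prod>l=j+1..m. ?r l))"
    by (rule Suc.IH) (use Suc.prems in simp)
  have "(\<Sum>j=1..Suc m. ?e j * (\<Prod>l=j+1..Suc m. ?r l))
      = (\<Sum>j=1..m. ?e j * (\<Prod>l=j+1..Suc m. ?r l)) + ?e (Suc m)"
    by simp
  also have "(\<Sum>j=1..m. ?e j * (\<Prod>l=j+1..Suc m. ?r l)) = ?r (Suc m) * (\<Sum>j=1..m. ?e j * (\<Prod>l=j+1..m. ?r l))"
    unfolding sum_distrib_left by (intro sum.cong) (auto simp: mult_ac)
  finally have sum: "(\<Sum>j=1..Suc m. ?e j * (\<Prod>l=j+1..Suc m. ?r l))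
      = ?r (Suc m) * (\<Sum>j=1..m. ?e j * (\<Prod>l=j+1..m. ?r l)) + ?e (Suc m)" .
  have prod: "(\<Prod>l=1..Suc m. ?r l) = ?r (Suc m) * (\<Prod>l=1..m. ?r l)"
    by (simp add: mult.commute)
  show ?case
    unfolding step IH sum prod by (simp add: distrib_left mult.assoc add.assoc)
qed simp

end
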